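(* Let $n\ge3$, $1\le m\le n-1$, and let $P\subset SL_n(\mathbb C)$ be the maximal parabolic subgroup corresponding to $I_P=\{1,\dots,n-1\}\setminus\{m\}$. Then $$\pi_P(t_{-\theta})=s_ms_{m+1}\cdots s_{n-1}\,s_{m-1}s_{m-2}\cdots s_1s_0 .$$
   Context: $\tilde S_n$ ($n\ge3$) is the affine symmetric group, generated by $s_0,\dots,s_{n-1}$ (indices mod $n$) with $s_i^2=1$, $s_is_{i+1}s_i=s_{i+1}s_is_{i+1}$, and $s_is_j=s_js_i$ if $i-j\not\equiv\pm1$; $S_n=\langle s_1,\dots,s_{n-1}\rangle$. Roots: $\alpha_i=\vec e_i-\vec e_{i+1}\in\mathbb R^n$ ($1\le i\le n-1$), $R=\{\vec e_i-\vec e_j:i\ne j\}$, $R^+=\{\vec e_i-\vec e_j:i<j\}$, $Q=\mathbb ZR$, highest root $\theta=\vec e_1-\vec e_n$. Translations: $\tilde S_n$ acts faithfully on the hyperplane $V=\mathrm{span}(R)\subset\mathbb R^n$ by affine maps, with $s_i$ ($1\le i\le n-1$) exchanging coordinates $i,i+1$ and $s_0(c_1,\dots,c_n)=(c_n+1,c_2,\dots,c_{n-1},c_1-1)$. For $\lambda\in Q$, $t_\lambda\in\tilde S_n$ is the element acting as translation by $\lambda$; $\tilde S_n=S_n\ltimes\{t_\lambda:\lambda\in Q\}$. Affine roots: $\delta=\alpha_0+\theta$ (with $\alpha_0$ a formal extra root), $R_{af}=\{\alpha+p\delta:\alpha\in R,p\in\mathbb Z\}$, $R_{af}^+=\{\alpha+p\delta:\alpha\in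 R,p>0\}\cup R^+$. The level-zero action of $\tilde S_n$ on $R_{af}$ is linear with $s_j\delta=\delta$, $s_j\alpha_j=-\alpha_j$, $s_j\alpha_i=\alpha_i+\alpha_j$ if $i-j\equiv\pm1\pmod n$, $s_j\alpha_i=\alpha_i$ otherwise. For $I_P=\{1,\dots,n-1\}\setminus\{m\}$: $R_P=\{\vec e_i-\vec e_j:i\ne j,\ 1\le i,j\le m\text{ or }m+1\le i,j\le n\}$, $Q_P=\mathbb ZR_P$, $(S_n)_P=\langle s_i:i\in I_P\rangle\cong S_m\times S_{n-m}$, $(R_P)^+_{af}=\{\alpha+p\delta\in R^+_{af}:\alpha\in R_P\}$, $$\tilde S_n^P=\{w\in\tilde S_n:w\cdot\beta\in R_{af}^+\text{ for all }\beta\in(R_P)^+_{af}\},\qquad(\tilde S_n)_P=\{vt_\lambda:\lambda\in Q_P,\ v\in(S_n)_P\}.$$ Every $w\in\tilde S_n$ has a unique factorization $w=w_1w_2$ with $w_1\in\tilde S_n^P$, $w_2\in(\tilde S_n)_P$, and $\pi_P:\tilde S_n\to\tilde S_n^P$ is defined by $\pi_P(w)=w_1$. *)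

theory Defs
  imports
    Complex_Main
    "HOL-Algebra.Generated_Groups"
    "HOL-Number_Theory.Cong"
    "HOL-Combinatorics.Transposition"
    "HOL-Library.Function_Algebras"
    "HOL-Library.Product_Plus"
begin

section \<open>The affine symmetric group, by its presentation\<close>

definition cyc_adj :: "nat \<Rightarrow> nat \<Rightarrow> nat \<Rightarrow> bool" where
  "cyc_adj n i j \<longleftrightarrow> [int i - int j = 1] (mod int n) \<or> [int i - int j = - 1] (mod int n)"

text \<open>The letter \<open>i < n\<close> stands for the generator \<open>s\<^sub>i\<close>. The inverse of a generator is the
  generator itself, so every element of the group is represented by a word in the letters, and the
  relation below is the congruence on words generated by the defining relations.\<close>

inductive_set word_rel :: "nat \<Rightarrow> (nat list \<times> nat list) set" for n :: nat where
  refl: "u \<in> lists {..<n} \<Longrightarrow> (u, u) \<in> word_rel n"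
| sym: "(u, v) \<in> word_rel n \<Longrightarrow> (v, u) \<in> word_rel n"
| trans: "(u, v) \<in> word_rel n \<Longrightarrow> (v, w) \<in> word_rel n \<Longrightarrow> (u, w) \<in> word_rel n"
| append: "(u, v) \<in> word_rel n \<Longrightarrow> (u', v') \<in> word_rel n \<Longrightarrow> (u @ u', v @ v') \<in> word_rel n"
| invol: "i < n \<Longrightarrow> ([i, i], []) \<in> word_rel n"
| braid: "i < n \<Longrightarrow> j = (i + 1) mod n \<Longrightarrow> ([i, j, i], [j, i, j]) \<in> word_rel n"
| comm: "i < n \<Longrightarrow> j < n \<Longrightarrow> \<not> cyc_adj n i j \<Longrightarrow> ([i, j], [j, i]) \<in> word_rel n"

definition aff_sym :: "nat \<Rightarrow> nat list set monoid" where
  "aff_sym n =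
    \<lparr>carrier = lists {..<n} // word_rel n,
     monoid.mult = (\<lambda>A B. \<Union>u\<in>A. \<Union>v\<in>B. word_rel n `` {u @ v}),
     monoid.one = word_rel n `` {[]}\<rparr>"

definition gen :: "nat \<Rightarrow> nat \<Rightarrow> nat list set" where
  "gen n i = word_rel n `` {[i]}"

definition gen_prod :: "nat \<Rightarrow> nat list \<Rightarrow> nat list set" where
  "gen_prod n is = foldr (\<lambda>i x. gen n i \<otimes>\<^bsub>aff_sym n\<^esub> x) is \<one>\<^bsub>aff_sym n\<^esub>"


section \<open>Finite roots\<close>

text \<open>Vectors of \<open>\<real>\<^sup>n\<close> are functions \<open>nat \<Rightarrow> real\<close> that vanish outside \<open>{1..n}\<close>, with pointwise
  addition. The two spans below are only used for finite sets of vectors.\<close>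

definition evec :: "nat \<Rightarrow> nat \<Rightarrow> real" where
  "evec i = (\<lambda>k. if k = i then 1 else 0)"

definition scal :: "real \<Rightarrow> (nat \<Rightarrow> real) \<Rightarrow> nat \<Rightarrow> real" where
  "scal a v = (\<lambda>k. a * v k)"

definition real_span :: "(nat \<Rightarrow> real) set \<Rightarrow> (nat \<Rightarrow> real) set" where
  "real_span A = {\<Sum>\<alpha>\<in>A. scal (f \<alpha>) \<alpha> | f :: (nat \<Rightarrow> real) \<Rightarrow> real. True}"

definition int_span :: "(nat \<Rightarrow> real) set \<Rightarrow> (nat \<Rightarrow> real) set" where
  "int_span A = {\<Sum>\<alpha>\<in>A. scal (of_int (f \<alpha>)) \<alpha> | f :: (nat \<Rightarrow> real) \<Rightarrow> int. True}"

definition simple_root :: "nat \<Rightarrow> nat \<Rightarrow> real" where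
  "simple_root i = evec i - evec (i + 1)"

definition theta :: "nat \<Rightarrow> nat \<Rightarrow> real" where
  "theta n = evec 1 - evec n"

definition roots :: "nat \<Rightarrow> (nat \<Rightarrow> real) set" where
  "roots n = {evec i - evec j | i j. i \<in> {1..n} \<and> j \<in> {1..n} \<and> i \<noteq> j}"

definition pos_roots :: "nat \<Rightarrow> (nat \<Rightarrow> real) set" where
  "pos_roots n = {evec i - evec j | i j. i \<in> {1..n} \<and> j \<in> {1..n} \<and> i < j}"

definition root_lattice :: "nat \<Rightarrow> (nat \<Rightarrow> real) set" where
  "root_lattice n = int_span (roots n)"

definition V :: "nat \<Rightarrow> (nat \<Rightarrow> real) set" where
  "V n = real_span (roots n)"


section \<open>Affine action and translations\<close>

definition aff_act_gen :: "nat \<Rightarrow> nat \<Rightarrow> (nat \<Rightarrow> real) \<Rightarrow> nat \<Rightarrow> real" where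
  "aff_act_gen n i c =
    (if i = 0 then c(1 := c n + 1, n := c 1 - 1) else c \<circ> transpose i (i + 1))"

text \<open>A group element is a class of words; all words in a class act in the same way, and this common
  value is picked out by \<^const>\<open>the_elem\<close>.\<close>

definition aff_act :: "nat \<Rightarrow> nat list set \<Rightarrow> (nat \<Rightarrow> real) \<Rightarrow> nat \<Rightarrow> real" where
  "aff_act n w c = the_elem ((\<lambda>u. foldr (aff_act_gen n) u c) ` w)"

definition transl :: "nat \<Rightarrow> (nat \<Rightarrow> real) \<Rightarrow> nat list set" where
  "transl n l = (THE w. w \<in> carrier (aff_sym n) \<and> (\<forall>c\<in>V n. aff_act n w c = c + l))"


section \<open>Affine roots and the level-zero action\<close>

text \<open>The pair \<open>(\<alpha>, p)\<close> encodes \<open>\<alpha> + p\<delta>\<close>; since \<open>\<delta> = \<alpha>\<^sub>0 + \<theta>\<close>, the formal root \<open>\<alpha>\<^sub>0\<close> is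
  \<open>(- \<theta>, 1)\<close>. Pairs are added componentwise.\<close>

type_synonym aff_vec = "(nat \<Rightarrow> real) \<times> int"

definition aff_scal :: "int \<Rightarrow> aff_vec \<Rightarrow> aff_vec" where
  "aff_scal a b = (scal (of_int a) (fst b), a * snd b)"

definition aff_simple_root :: "nat \<Rightarrow> nat \<Rightarrow> aff_vec" where
  "aff_simple_root n i = (if i = 0 then (- theta n, 1) else (simple_root i, 0))"

definition aff_roots :: "nat \<Rightarrow> aff_vec set" where
  "aff_roots n = {(\<alpha>, p) | \<alpha> p. \<alpha> \<in> roots n}"

definition pos_aff_roots :: "nat \<Rightarrow> aff_vec set" where
  "pos_aff_roots n = {(\<alpha>, p) | \<alpha> p. \<alpha> \<in> roots n \<and> p > 0} \<union> {(\<alpha>, 0) | \<alpha>. \<alpha> \<in> pos_roots n}"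

definition lz_simple :: "nat \<Rightarrow> nat \<Rightarrow> nat \<Rightarrow> aff_vec" where
  "lz_simple n j i =
    (if i = j then - aff_simple_root n j
     else if cyc_adj n i j then aff_simple_root n i + aff_simple_root n j
     else aff_simple_root n i)"

text \<open>The simple affine roots are a basis of the affine root lattice; the action of \<open>s\<^sub>j\<close> is the
  linear extension of its values \<^const>\<open>lz_simple\<close> on this basis. That it fixes \<open>\<delta>\<close>, the
  sum of the simple affine roots, is a consequence.\<close>

definition aff_coords :: "nat \<Rightarrow> aff_vec \<Rightarrow> nat \<Rightarrow> int" where
  "aff_coords n b =
    (THE a. (\<forall>i\<ge>n. a i = 0) \<and> b = (\<Sum>i<n. aff_scal (a i) (aff_simple_root n i)))"

definition lz_gen :: "nat \<Rightarrow> nat \<Rightarrow> aff_vec \<Rightarrow> aff_vec" where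
  "lz_gen n j b = (\<Sum>i<n. aff_scal (aff_coords n b i) (lz_simple n j i))"

definition lz_act :: "nat \<Rightarrow> nat list set \<Rightarrow> aff_vec \<Rightarrow> aff_vec" where
  "lz_act n w b = the_elem ((\<lambda>u. foldr (lz_gen n) u b) ` w)"


section \<open>The maximal parabolic and its factorization\<close>

definition I_P :: "nat \<Rightarrow> nat \<Rightarrow> nat set" where
  "I_P n m = {1..n - 1} - {m}"

definition roots_P :: "nat \<Rightarrow> nat \<Rightarrow> (nat \<Rightarrow> real) set" where
  "roots_P n m = {evec i - evec j | i j.
     i \<noteq> j \<and> (i \<in> {1..m} \<and> j \<in> {1..m} \<or> i \<in> {m + 1..n} \<and> j \<in> {m + 1..n})}"

definition root_lattice_P :: "nat \<Rightarrow> nat \<Rightarrow> (nat \<Rightarrow> real) set" where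
  "root_lattice_P n m = int_span (roots_P n m)"

definition sym_P :: "nat \<Rightarrow> nat \<Rightarrow> nat list set set" where
  "sym_P n m = generate (aff_sym n) (gen n ` I_P n m)"

definition pos_aff_roots_P :: "nat \<Rightarrow> nat \<Rightarrow> aff_vec set" where
  "pos_aff_roots_P n m = {b \<in> pos_aff_roots n. fst b \<in> roots_P n m}"

definition aff_sym_upper_P :: "nat \<Rightarrow> nat \<Rightarrow> nat list set set" where
  "aff_sym_upper_P n m =
    {w \<in> carrier (aff_sym n). \<forall>b \<in> pos_aff_roots_P n m. lz_act n w b \<in> pos_aff_roots n}"

definition aff_sym_lower_P :: "nat \<Rightarrow> nat \<Rightarrow> nat list set set" where
  "aff_sym_lower_P n m =
    {v \<otimes>\<^bsub>aff_sym n\<^esub> transl n l | v l. l \<in> root_lattice_P n m \<and> v \<in> sym_P n m}"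

definition pi_P :: "nat \<Rightarrow> nat \<Rightarrow> nat list set \<Rightarrow> nat list set" where
  "pi_P n m w =
    (THE w1. w1 \<in> aff_sym_upper_P n m \<and>
      (\<exists>w2 \<in> aff_sym_lower_P n m. w = w1 \<otimes>\<^bsub>aff_sym n\<^esub> w2))"

end

theory Submission
  imports Defs
begin

text \<open>
  Elements of the group are represented by words acting on \<open>\<real>\<^sup>n\<close>. The action on the single point
  \<open>\<rho> / n\<close> of the fundamental alcove is already faithful: reflecting a point of its orbit in any wall
  that separates it from the alcove decreases the distance to \<open>\<rho> / n\<close>, and by the commutation and
  braid relations any two such reflections can be completed to a common sequence, so all ways of
  folding the point into the alcove give equivalent words.

  Read as affine functions on \<open>\<real>\<^sup>n\<close>, the affine roots satisfy \<open>(w \<beta>)(c) = \<beta>(w\<^sup>-\<^sup>1 c)\<close>, and a root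
  is positive iff it is positive at \<open>\<rho> / n\<close>. Hence \<open>w\<close> is a minimal representative iff
  \<open>y = w\<^sup>-\<^sup>1(\<rho> / n)\<close> satisfies \<open>0 < y\<^sub>a - y\<^sub>b < 1\<close> for all \<open>a < b\<close> in the same block \<open>{1..m}\<close> or
  \<open>{m+1..n}\<close>. An element of the parabolic subgroup preserves, block by block, the sum of the
  coordinates and their classes modulo 1, and these data determine such a \<open>y\<close>; this gives
  uniqueness of the factorization. Finally, with \<open>u\<close> the claimed word,
  \<open>t\<^bsub>-\<theta>\<^esub> = u v t\<^bsub>\<lambda>\<^esub>\<close> for
  \<open>v = s\<^sub>1 \<dots> s\<^bsub>m-1\<^esub> s\<^bsub>n-1\<^esub> \<dots> s\<^bsub>m+1\<^esub>\<close> and \<open>\<lambda> = (e\<^sub>m - e\<^sub>1) + (e\<^sub>n - e\<^bsub>m+1\<^esub>)\<close>.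
\<close>

section \<open>Words and their affine action\<close>

lemma cyc_adj_iff:
  assumes "i < n" "j < n" "3 \<le> n"
  shows "cyc_adj n i j \<longleftrightarrow> i = j + 1 \<or> j = i + 1 \<or> i = 0 \<and> j + 1 = n \<or> j = 0 \<and> i + 1 = n"
proof -
  \<comment> \<open>Both differences tested below have absolute value at most n, hence less than
    \<open>2 * int n\<close>, and so only the multiples 0, n and -n are possible.\<close>
  have dvd_small: "int n dvd z \<longleftrightarrow> z = 0 \<or> z = int n \<or> z = - int n"
    if "\<bar>z\<bar> < 2 * int n" for z
  proof
    assume "int n dvd z"
    then obtain k where k: "z = int n * k" by blast
    then have "\<bar>k\<bar> * int n < 2 * int n" using that by (simp add: abs_mult mult.commute)
    then have "k \<in> {-1, 0, 1}" using assms by auto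
    then show "z = 0 \<or> z = int n \<or> z = - int n" using k by auto
  qed auto
  show ?thesis
    unfolding cyc_adj_def cong_iff_dvd_diff
    using assms dvd_small[of "int i - int j - 1"] dvd_small[of "int i - int j - - 1"] by auto
qed

lemma aff_act_gen_invol: "3 \<le> n \<Longrightarrow> i < n \<Longrightarrow> aff_act_gen n i (aff_act_gen n i c) = c"
  by (auto simp: aff_act_gen_def fun_eq_iff transpose_def)

lemma aff_act_gen_braid:
  assumes "3 \<le> n" "i < n" "j = (i + 1) mod n"
  shows "aff_act_gen n i (aff_act_gen n j (aff_act_gen n i c))
    = aff_act_gen n j (aff_act_gen n i (aff_act_gen n j c))"
proof -
  consider "i = 0" "j = 1" | "i > 0" "j = i + 1" "i + 1 < n" | "i + 1 = n" "j = 0" "i > 0"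
    using assms by (cases "i + 1 = n"; cases "i = 0") auto
  then show ?thesis
    using assms(1) by cases (auto simp: aff_act_gen_def fun_eq_iff transpose_def)
qed

text \<open>A form common to \<open>s_0\<close> and the finite generators: two coordinates are
  exchanged and shifted oppositely. Commutation then reduces to disjointness of the coordinate
  pairs.\<close>

lemma aff_act_gen_upd:
  assumes "p = (if i = 0 then 1 else i)" "q = (if i = 0 then n else i + 1)"
    and "z = (if i = 0 then 1 else 0)"
  shows "aff_act_gen n i c = c(p := c q + z, q := c p - z)"
  using assms by (auto simp: aff_act_gen_def fun_eq_iff transpose_def)

lemma aff_act_gen_comm:
  assumes "3 \<le> n" "i < n" "j < n" "\<not> cyc_adj n i j"
  shows "aff_act_gen n i (aff_act_gen n j c) = aff_act_gen n j (aff_act_gen n i c)"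
proof (cases "i = j")
  case False
  define p q p' q'
    where pq: "p = (if i = 0 then 1 else i)" "q = (if i = 0 then n else i + 1)"
      "p' = (if j = 0 then 1 else j)" "q' = (if j = 0 then n else j + 1)"
  define z z' :: real where z: "z = (if i = 0 then 1 else 0)" "z' = (if j = 0 then 1 else 0)"
  note upd = aff_act_gen_upd[OF pq(1,2) z(1)] aff_act_gen_upd[OF pq(3,4) z(2)]
  have "\<not> (i = j + 1 \<or> j = i + 1 \<or> i = 0 \<and> j + 1 = n \<or> j = 0 \<and> i + 1 = n)"
    using assms(4) unfolding cyc_adj_iff[OF assms(2,3,1)] .
  then have "p \<noteq> p'" "p \<noteq> q'" "q \<noteq> p'" "q \<noteq> q'"
    using assms(1-3) False pq by (simp_all split: if_splits)
  then show ?thesis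
    unfolding upd by (simp add: fun_eq_iff)
qed simp

lemma word_rel_lists:
  assumes "(u, v) \<in> word_rel n"
  shows "u \<in> lists {..<n} \<and> v \<in> lists {..<n}"
  using assms by induction auto

text \<open>Each defining relation reverses to a defining relation, possibly with its sides
  exchanged. Since generators are involutions, \<open>rev\<close> represents the inverse.\<close>

lemma word_rel_rev: "(u, v) \<in> word_rel n \<Longrightarrow> (rev u, rev v) \<in> word_rel n"
proof (induction rule: word_rel.induct)
  case (comm i j)
  then show ?case
    using word_rel.sym[OF word_rel.comm] by simp
qed (auto intro: word_rel.intros)

abbreviation wact :: "nat \<Rightarrow> nat list \<Rightarrow> (nat \<Rightarrow> real) \<Rightarrow> nat \<Rightarrow> real" where
  "wact n \<equiv> foldr (aff_act_gen n)"

abbreviation wcls :: "nat \<Rightarrow> nat list \<Rightarrow> nat list set" where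
  "wcls n u \<equiv> word_rel n `` {u}"

lemma wact_word_rel:
  assumes "(u, v) \<in> word_rel n" "3 \<le> n"
  shows "wact n u c = wact n v c"
  using assms
proof (induction arbitrary: c)
  case (braid i j)
  then show ?case using aff_act_gen_braid[of n i j c] by simp
next
  case (comm i j)
  then show ?case using aff_act_gen_comm[of n i j c] by simp
qed (simp_all add: aff_act_gen_invol)

lemma wact_rev: "u \<in> lists {..<n} \<Longrightarrow> 3 \<le> n \<Longrightarrow> wact n (rev u) (wact n u c) = c"
  by (induction u arbitrary: c) (auto simp: aff_act_gen_invol)

lemma wact_rev': "u \<in> lists {..<n} \<Longrightarrow> 3 \<le> n \<Longrightarrow> wact n u (wact n (rev u) c) = c"
  using wact_rev[of "rev u"] by (simp add: in_lists_conv_set)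

section \<open>The group of word classes\<close>

lemma equiv_word_rel: "equiv (lists {..<n}) (word_rel n)"
  by (rule equivI)
    (auto simp: refl_on_def intro!: symI transI intro: word_rel.intros dest: word_rel_lists)

lemma wcls_eq_iff:
  "u \<in> lists {..<n} \<Longrightarrow> v \<in> lists {..<n} \<Longrightarrow> wcls n u = wcls n v \<longleftrightarrow> (u, v) \<in> word_rel n"
  by (rule eq_equiv_class_iff[OF equiv_word_rel])

lemma carrier_aff_sym: "carrier (aff_sym n) = wcls n ` lists {..<n}"
  by (auto simp: aff_sym_def quotient_def)

lemma one_aff_sym: "\<one>\<^bsub>aff_sym n\<^esub> = wcls n []"
  by (simp add: aff_sym_def)

lemma mult_wcls:
  assumes "u \<in> lists {..<n}" "v \<in> lists {..<n}"
  shows "wcls n u \<otimes>\<^bsub>aff_sym n\<^esub> wcls n v = wcls n (u @ v)"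
proof -
  \<comment> \<open>The union defining the product runs over all pairs of representatives; every
    pair contributes the same class.\<close>
  have *: "wcls n (u' @ v') = wcls n (u @ v)"
    if "(u, u') \<in> word_rel n" "(v, v') \<in> word_rel n" for u' v'
    using equiv_class_eq[OF equiv_word_rel word_rel.append[OF that]] by (rule HOL.sym)
  have "wcls n u \<otimes>\<^bsub>aff_sym n\<^esub> wcls n v = (\<Union>u'\<in>wcls n u. \<Union>v'\<in>wcls n v. wcls n (u' @ v'))"
    by (simp add: aff_sym_def)
  also have "\<dots> = (\<Union>u'\<in>wcls n u. \<Union>v'\<in>wcls n v. wcls n (u @ v))"
    by (rule SUP_cong[OF HOL.refl], rule SUP_cong[OF HOL.refl], rule *) (simp_all only: Image_singleton_iff)
  also have "\<dots> = wcls n (u @ v)"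
    using equiv_class_self[OF equiv_word_rel assms(1)] equiv_class_self[OF equiv_word_rel assms(2)]
    by blast
  finally show ?thesis .
qed

lemma word_rel_rev_append: "u \<in> lists {..<n} \<Longrightarrow> (rev u @ u, []) \<in> word_rel n"
proof (induction u)
  case (Cons i u)
  then have "i < n" "u \<in> lists {..<n}" by auto
  have "((rev u @ [i, i]) @ u, (rev u @ []) @ u) \<in> word_rel n"
    using \<open>i < n\<close> \<open>u \<in> lists {..<n}\<close>
    by (intro word_rel.append word_rel.invol word_rel.refl) (auto simp: in_lists_conv_set)
  then show ?case
    using Cons.IH[OF \<open>u \<in> lists {..<n}\<close>] word_rel.trans by auto
qed (simp add: word_rel.refl)

lemma group_aff_sym: "group (aff_sym n)"
proof (rule groupI)
  fix x assume "x \<in> carrier (aff_sym n)"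
  then obtain u where u: "u \<in> lists {..<n}" "x = wcls n u" by (auto simp: carrier_aff_sym)
  then have "rev u \<in> lists {..<n}" by (simp add: in_lists_conv_set)
  then have "wcls n (rev u) \<otimes>\<^bsub>aff_sym n\<^esub> x = \<one>\<^bsub>aff_sym n\<^esub>"
    using u word_rel_rev_append[OF u(1)]
    by (simp add: mult_wcls one_aff_sym equiv_class_eq[OF equiv_word_rel])
  then show "\<exists>y\<in>carrier (aff_sym n). y \<otimes>\<^bsub>aff_sym n\<^esub> x = \<one>\<^bsub>aff_sym n\<^esub>"
    using \<open>rev u \<in> lists {..<n}\<close> by (auto simp: carrier_aff_sym)
next
  fix x y z assume "x \<in> carrier (aff_sym n)" "y \<in> carrier (aff_sym n)" "z \<in> carrier (aff_sym n)"
  then obtain u v w where *: "x = wcls n u" "y = wcls n v" "z = wcls n w"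
    "u \<in> lists {..<n}" "v \<in> lists {..<n}" "w \<in> lists {..<n}"
    unfolding carrier_aff_sym by blast
  then have "u @ v \<in> lists {..<n}" "v @ w \<in> lists {..<n}" by auto
  then show "x \<otimes>\<^bsub>aff_sym n\<^esub> y \<otimes>\<^bsub>aff_sym n\<^esub> z = x \<otimes>\<^bsub>aff_sym n\<^esub> (y \<otimes>\<^bsub>aff_sym n\<^esub> z)"
    using * by (simp only: mult_wcls append_assoc)
next
  fix x y assume "x \<in> carrier (aff_sym n)" "y \<in> carrier (aff_sym n)"
  then obtain u v where *: "x = wcls n u" "y = wcls n v" "u \<in> lists {..<n}" "v \<in> lists {..<n}"
    unfolding carrier_aff_sym by blast
  then have "u @ v \<in> lists {..<n}" by auto
  then show "x \<otimes>\<^bsub>aff_sym n\<^esub> y \<in> carrier (aff_sym n)"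
    unfolding carrier_aff_sym *(1,2) mult_wcls[OF *(3,4)] by blast
next
  fix x assume "x \<in> carrier (aff_sym n)"
  then obtain u where *: "x = wcls n u" "u \<in> lists {..<n}"
    unfolding carrier_aff_sym by blast
  then show "\<one>\<^bsub>aff_sym n\<^esub> \<otimes>\<^bsub>aff_sym n\<^esub> x = x"
    using mult_wcls[of "[]" n u] by (simp add: one_aff_sym)
qed (auto simp: carrier_aff_sym one_aff_sym)

lemma gen_prod_eq: "u \<in> lists {..<n} \<Longrightarrow> gen_prod n u = wcls n u"
proof (induction u)
  case (Cons i u)
  then show ?case using mult_wcls[of "[i]" n u] by (simp add: gen_prod_def gen_def)
qed (simp add: gen_prod_def one_aff_sym)

lemma aff_act_wcls:
  assumes "u \<in> lists {..<n}" "3 \<le> n"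
  shows "aff_act n (wcls n u) c = wact n u c"
proof -
  have "(\<lambda>v. wact n v c) ` wcls n u = (\<lambda>v. wact n u c) ` wcls n u"
    using wact_word_rel[OF _ assms(2)] by (intro image_cong) auto
  also have "\<dots> = {wact n u c}"
    using equiv_class_self[OF equiv_word_rel assms(1)] by (rule image_constant)
  finally have "(\<lambda>v. wact n v c) ` wcls n u = {wact n u c}" .
  then show ?thesis by (simp add: aff_act_def)
qed

section \<open>Faithfulness at a point of the fundamental alcove\<close>

text \<open>With \<open>\<rho>\<close> the half-sum of the positive roots, this is \<open>\<rho> / n\<close>.\<close>

definition alcove_pt :: "nat \<Rightarrow> nat \<Rightarrow> real" where
  "alcove_pt n k = (if 1 \<le> k \<and> k \<le> n then ((real n + 1) / 2 - real k) / real n else 0)"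

text \<open>The closed fundamental alcove is c_1 \<ge> ... \<ge> c_n \<ge> c_1 - 1, one inequality
  for each generator. The predicate is the strict failure of one of them, so points on the wall do
  not count.\<close>

definition beyond_wall :: "nat \<Rightarrow> nat \<Rightarrow> (nat \<Rightarrow> real) \<Rightarrow> bool" where
  "beyond_wall n i c \<longleftrightarrow> (if i = 0 then c 1 - c n > 1 else c i < c (i + 1))"

text \<open>The letters of the word are reflections in walls, each separating the current point from the
  fundamental alcove; the word ends once the point has been folded into the closed alcove.\<close>

inductive wall_folding :: "nat \<Rightarrow> (nat \<Rightarrow> real) \<Rightarrow> nat list \<Rightarrow> bool" for n where
  Nil: "(\<And>i. i < n \<Longrightarrow> \<not> beyond_wall n i c) \<Longrightarrow> wall_folding n c []"
| Cons: "i < n \<Longrightarrow> beyond_wall n i c \<Longrightarrow> wall_folding n (aff_act_gen n i c) w \<Longrightarrow> wall_folding n c (i # w)"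

text \<open>These are the properties of the orbit of \<open>alcove_pt\<close> on which folding
  rests: the first clause makes the scaled squared distance an integer, the second keeps the point
  off every reflection hyperplane.\<close>

definition regular :: "nat \<Rightarrow> (nat \<Rightarrow> real) \<Rightarrow> bool" where
  "regular n c \<longleftrightarrow> (\<forall>k\<in>{1..n}. real n * (c k - alcove_pt n k) \<in> \<int>)
    \<and> (\<forall>a\<in>{1..n}. \<forall>b\<in>{1..n}. a \<noteq> b \<longrightarrow> c a - c b \<notin> \<int>)"

lemma alcove_pt_diff:
  "a \<in> {1..n} \<Longrightarrow> b \<in> {1..n} \<Longrightarrow> alcove_pt n a - alcove_pt n b = (real b - real a) / real n"
  by (simp add: alcove_pt_def field_simps)

lemma alcove_pt_diff_bounds:
  assumes "a \<in> {1..n}" "b \<in> {1..n}" "a < b"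
  shows "0 < alcove_pt n a - alcove_pt n b" "alcove_pt n a - alcove_pt n b < 1"
  using assms by (auto simp: alcove_pt_diff field_simps)

lemma not_Ints_between:
  assumes "0 < (x::real)" "x < 1" shows "x \<notin> \<int>"
proof
  assume "x \<in> \<int>"
  then obtain z where "x = of_int z" by (auto elim: Ints_cases)
  then show False using assms by simp
qed

lemma regular_alcove_pt: "regular n (alcove_pt n)"
proof -
  have "alcove_pt n a - alcove_pt n b \<notin> \<int>" if "a \<in> {1..n}" "b \<in> {1..n}" "a \<noteq> b" for a b
  proof (cases "a < b")
    case True
    then show ?thesis using that alcove_pt_diff_bounds[of a n b] not_Ints_between by blast
  next
    case False
    then have "alcove_pt n b - alcove_pt n a \<notin> \<int>"
      using that alcove_pt_diff_bounds[of b n a] not_Ints_between by (metis linorder_neqE_nat)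
    then show ?thesis using Ints_minus[of "alcove_pt n a - alcove_pt n b"] by auto
  qed
  then show ?thesis by (simp add: regular_def)
qed

text \<open>Isolates what matters about a generator, a permutation of coordinates followed by
  integer shifts. This is used to preserve regularity and to send roots to roots.\<close>

lemma aff_act_gen_coords:
  assumes "i < n" "3 \<le> n"
  obtains s :: "nat \<Rightarrow> nat" and z :: "nat \<Rightarrow> int"
  where "\<And>c k. aff_act_gen n i c k = c (s k) + of_int (z k)"
    "\<And>k. k \<in> {1..n} \<Longrightarrow> s k \<in> {1..n}" "\<And>a b. a \<noteq> b \<Longrightarrow> s a \<noteq> s b"
proof
  define s where "s = (if i = 0 then transpose 1 n else transpose i (i + 1))"
  define z :: "nat \<Rightarrow> int" where
    "z k = (if i = 0 \<and> k = 1 then 1 else if i = 0 \<and> k = n then -1 else 0)" for k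
  show "aff_act_gen n i c k = c (s k) + of_int (z k)" for c k
    using assms by (auto simp: aff_act_gen_def s_def z_def transpose_def)
  show "s k \<in> {1..n}" if "k \<in> {1..n}" for k
    using that assms by (auto simp: s_def transpose_def)
  show "s a \<noteq> s b" if "a \<noteq> b" for a b
    using that by (auto simp: s_def transpose_def split: if_splits)
qed

lemma regular_aff_act_gen:
  assumes "regular n c" "i < n" "3 \<le> n"
  shows "regular n (aff_act_gen n i c)"
proof -
  obtain s z where c': "\<And>k. aff_act_gen n i c k = c (s k) + of_int (z k)"
    and s: "\<And>k. k \<in> {1..n} \<Longrightarrow> s k \<in> {1..n}" and inj: "\<And>a b. a \<noteq> b \<Longrightarrow> s a \<noteq> s b"
    by (rule aff_act_gen_coords[OF assms(2,3)]) (rule that)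
  have "real n * (aff_act_gen n i c k - alcove_pt n k) \<in> \<int>" if k: "k \<in> {1..n}" for k
  proof -
    have "real n * (aff_act_gen n i c k - alcove_pt n k) = real n * (c (s k) - alcove_pt n (s k))
      + (real n * (alcove_pt n (s k) - alcove_pt n k) + real n * of_int (z k))"
      by (simp add: c' algebra_simps)
    \<comment> \<open>Coordinates of \<open>alcove_pt\<close> differ by multiples of 1/n, so
      permuting coordinates keeps the scaled deviation integral.\<close>
    also have "real n * (alcove_pt n (s k) - alcove_pt n k) = real k - real (s k)"
      using alcove_pt_diff[OF s[OF k] k] assms by simp
    finally show ?thesis
      using assms(1) s[OF k] by (simp add: regular_def)
  qed
  moreover have "aff_act_gen n i c a - aff_act_gen n i c b \<notin> \<int>"
    if "a \<in> {1..n}" "b \<in> {1..n}" "a \<noteq> b" for a b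
  proof
    assume "aff_act_gen n i c a - aff_act_gen n i c b \<in> \<int>"
    then have "aff_act_gen n i c a - aff_act_gen n i c b - of_int (z a - z b) \<in> \<int>"
      by (rule Ints_diff) simp
    then have "c (s a) - c (s b) \<in> \<int>" by (simp add: c')
    then show False using assms(1) s inj that by (auto simp: regular_def)
  qed
  ultimately show ?thesis by (simp add: regular_def)
qed

lemma regular_wact:
  "u \<in> lists {..<n} \<Longrightarrow> 3 \<le> n \<Longrightarrow> regular n c \<Longrightarrow> regular n (wact n u c)"
  by (induction u) (auto intro: regular_aff_act_gen)

text \<open>The scaling by \<open>n\<close> makes this an integer on the orbit of \<^const>\<open>alcove_pt\<close>, hence a
  termination measure for folding.\<close>

definition sq_dist :: "nat \<Rightarrow> (nat \<Rightarrow> real) \<Rightarrow> real" where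
  "sq_dist n c = (\<Sum>k\<in>{1..n}. (real n * (c k - alcove_pt n k))\<^sup>2)"

text \<open>Only two coordinates move, and the change equals \<open>2 * n^2\<close> times the
  product of the signed wall distances of \<open>c\<close> and of \<open>alcove_pt\<close>. The two
  factors have opposite signs because the wall separates the points.\<close>

lemma sq_dist_aff_act_gen_less:
  assumes "beyond_wall n i c" "i < n" "3 \<le> n"
  shows "sq_dist n (aff_act_gen n i c) < sq_dist n c"
proof -
  define p q where "p = (if i = 0 then n else i)" and "q = (if i = 0 then 1 else i + 1)"
  let ?d = "\<lambda>k. (real n * (aff_act_gen n i c k - alcove_pt n k))\<^sup>2
    - (real n * (c k - alcove_pt n k))\<^sup>2"
  have pq: "p \<noteq> q" "p \<in> {1..n}" "q \<in> {1..n}"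
    using assms by (auto simp: p_def q_def)
  have "sq_dist n (aff_act_gen n i c) - sq_dist n c = (\<Sum>k\<in>{1..n}. ?d k)"
    by (simp add: sq_dist_def sum_subtractf)
  also have "\<dots> = (\<Sum>k\<in>{p, q}. ?d k)"
    using pq assms
    by (intro sum.mono_neutral_right)
      (auto simp: aff_act_gen_def p_def q_def transpose_def split: if_splits)
  also have "\<dots> = ?d p + ?d q" using pq by simp
  also have "\<dots> < 0"
  proof (cases "i = 0")
    case True
    have "?d p + ?d q = 2 * (real n)\<^sup>2 * ((c 1 - c n - 1) * ((alcove_pt n 1 - alcove_pt n n) - 1))"
      using True assms
      by (simp add: aff_act_gen_def p_def q_def power2_eq_square algebra_simps)
    also have "(alcove_pt n 1 - alcove_pt n n) - 1 < 0"
      using alcove_pt_diff_bounds(2)[of 1 n n] assms by simp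
    then have "2 * (real n)\<^sup>2 * ((c 1 - c n - 1) * ((alcove_pt n 1 - alcove_pt n n) - 1)) < 0"
      using assms True by (intro mult_pos_neg) (auto simp: beyond_wall_def)
    finally show ?thesis .
  next
    case False
    have "?d p + ?d q
      = 2 * (real n)\<^sup>2 * ((c i - c (i + 1)) * (alcove_pt n i - alcove_pt n (i + 1)))"
      using False assms
      by (simp add: aff_act_gen_def p_def q_def power2_eq_square algebra_simps)
    also have "alcove_pt n i - alcove_pt n (i + 1) > 0"
      using assms False by (intro alcove_pt_diff_bounds) auto
    then have "2 * (real n)\<^sup>2 * ((c i - c (i + 1)) * (alcove_pt n i - alcove_pt n (i + 1))) < 0"
      using assms False by (intro mult_pos_neg mult_neg_pos) (auto simp: beyond_wall_def)
    finally show ?thesis .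
  qed
  finally show ?thesis by simp
qed

lemma sq_dist_Ints: "regular n c \<Longrightarrow> sq_dist n c \<in> \<int>"
  by (auto simp: regular_def sq_dist_def intro!: Ints_sum Ints_power)

lemma sq_dist_measure:
  assumes "beyond_wall n i c" "i < n" "3 \<le> n" "regular n c"
  shows "nat \<lfloor>sq_dist n (aff_act_gen n i c)\<rfloor> < nat \<lfloor>sq_dist n c\<rfloor>"
proof -
  have "sq_dist n c \<in> \<int>" "sq_dist n (aff_act_gen n i c) \<in> \<int>"
    using assms by (auto intro: sq_dist_Ints regular_aff_act_gen)
  then obtain y z where yz: "sq_dist n c = of_int y" "sq_dist n (aff_act_gen n i c) = of_int z"
    by (auto elim!: Ints_cases)
  moreover have "sq_dist n (aff_act_gen n i c) \<ge> 0"
    by (auto simp: sq_dist_def intro: sum_nonneg)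
  ultimately show ?thesis using sq_dist_aff_act_gen_less[OF assms(1-3)] by simp
qed

lemma wall_folding_exists:
  assumes "regular n c" "3 \<le> n"
  shows "\<exists>w\<in>lists {..<n}. wall_folding n c w"
  using assms
proof (induction "nat \<lfloor>sq_dist n c\<rfloor>" arbitrary: c rule: less_induct)
  case less
  show ?case
  proof (cases "\<exists>i<n. beyond_wall n i c")
    case True
    then obtain i where i: "i < n" "beyond_wall n i c" by blast
    then obtain w where "w \<in> lists {..<n}" "wall_folding n (aff_act_gen n i c) w"
      using less sq_dist_measure regular_aff_act_gen by meson
    then show ?thesis using i by (intro bexI[of _ "i # w"]) (auto intro: wall_folding.Cons)
  next
    case False
    then show ?thesis by (intro bexI[of _ "[]"]) (auto intro: wall_folding.Nil)
  qed
qed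

section \<open>Local confluence and uniqueness of folding\<close>

lemma wall_folding_lists: "wall_folding n c w \<Longrightarrow> w \<in> lists {..<n}"
  by (induction rule: wall_folding.induct) auto

lemma beyond_wall_comm:
  assumes "beyond_wall n i c" "beyond_wall n j c" "i \<noteq> j" "\<not> cyc_adj n i j" "i < n" "j < n" "3 \<le> n"
  shows "beyond_wall n j (aff_act_gen n i c)"
  using assms by (auto simp: cyc_adj_iff beyond_wall_def aff_act_gen_def transpose_def)

text \<open>When both adjacent walls separate the point from the alcove, the three coordinates
  involved are in fully reversed order (up to the shift of \<open>s_0\<close>). Each of the three
  reflections in the braid word therefore still crosses a separating wall.\<close>

lemma beyond_wall_braid:
  assumes "beyond_wall n i c" "beyond_wall n j c" "cyc_adj n i j" "i < n" "j < n" "3 \<le> n"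
  shows "beyond_wall n j (aff_act_gen n i c)"
    "beyond_wall n i (aff_act_gen n j (aff_act_gen n i c))"
  using assms
  by (auto simp: cyc_adj_iff beyond_wall_def aff_act_gen_def transpose_def split: if_splits)

lemma word_rel_braid:
  assumes "cyc_adj n i j" "i < n" "j < n" "3 \<le> n"
  shows "([i, j, i], [j, i, j]) \<in> word_rel n"
proof -
  have "j = (i + 1) mod n \<or> i = (j + 1) mod n"
    using assms by (auto simp: cyc_adj_iff)
  then show ?thesis
    using assms by (auto intro: word_rel.braid word_rel.sym[OF word_rel.braid])
qed

lemma aff_act_gen_braid':
  assumes "cyc_adj n i j" "i < n" "j < n" "3 \<le> n"
  shows "aff_act_gen n i (aff_act_gen n j (aff_act_gen n i c))
    = aff_act_gen n j (aff_act_gen n i (aff_act_gen n j c))"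
  using wact_word_rel[OF word_rel_braid[OF assms], of c] assms by simp

lemma cyc_adj_sym: "cyc_adj n i j \<Longrightarrow> cyc_adj n j i"
  by (auto simp: cyc_adj_def cong_iff_dvd_diff dvd_diff_commute algebra_simps)

lemma word_rel_Cons: "i < n \<Longrightarrow> (u, v) \<in> word_rel n \<Longrightarrow> (i # u, i # v) \<in> word_rel n"
  using word_rel.append[OF word_rel.refl[of "[i]" n]] by simp

text \<open>The diamond argument: foldings through two different walls can be completed to a common one.\<close>

lemma wall_folding_unique:
  assumes "wall_folding n c w" "wall_folding n c w'" "regular n c" "3 \<le> n"
  shows "(w, w') \<in> word_rel n"
  using assms
proof (induction "nat \<lfloor>sq_dist n c\<rfloor>" arbitrary: c w w' rule: less_induct)
  case less
  show ?case
  proof (cases "w = []")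
    case True
    \<comment> \<open>An empty folding certifies that no wall separates the point from the alcove,
      so no other folding can take a first step.\<close>
    have "w' = []"
      using less.prems(2,1) True by cases (auto elim: wall_folding.cases)
    then show ?thesis using True by (auto intro: word_rel.refl)
  next
    case False
    then obtain i u where u: "w = i # u" "i < n" "beyond_wall n i c" "wall_folding n (aff_act_gen n i c) u"
      using less.prems(1) by (auto elim: wall_folding.cases)
    from less.prems(2) obtain j v
      where v: "w' = j # v" "j < n" "beyond_wall n j c" "wall_folding n (aff_act_gen n j c) v"
      using u by (auto elim: wall_folding.cases)
    note n = \<open>3 \<le> n\<close>
    have reg: "regular n (aff_act_gen n i c)" "regular n (aff_act_gen n j c)"
      using less.prems u v by (auto intro: regular_aff_act_gen)
    have IHi: "(u, x) \<in> word_rel n" if "wall_folding n (aff_act_gen n i c) x" for x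
      using less.hyps[OF _ u(4) that reg(1) n] sq_dist_measure u less.prems by blast
    have IHj: "(x, v) \<in> word_rel n" if "wall_folding n (aff_act_gen n j c) x" for x
      using less.hyps[OF _ that v(4) reg(2) n] sq_dist_measure v less.prems by blast
    consider "i = j" | "i \<noteq> j" "\<not> cyc_adj n i j" | "cyc_adj n i j" by blast
    then show ?thesis
    proof cases
      case 1
      then show ?thesis using IHi v u by (auto intro: word_rel_Cons)
    next
      case 2
      then have sym2: "\<not> cyc_adj n j i" using cyc_adj_sym by blast
      \<comment> \<open>A folding of the common descendant of both branches. The induction
        hypothesis replaces \<open>u\<close> by \<open>j # x\<close> and \<open>v\<close> by
        \<open>i # x\<close>, and one commutation joins the two; the adjacent case below does the
        same with the braid relation.\<close>
      obtain x where x: "x \<in> lists {..<n}" "wall_folding n (aff_act_gen n j (aff_act_gen n i c)) x"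
        using wall_folding_exists regular_aff_act_gen reg v n by meson
      have "wall_folding n (aff_act_gen n i c) (j # x)"
        using x v u 2 n by (intro wall_folding.Cons beyond_wall_comm)
      moreover have "wall_folding n (aff_act_gen n j c) (i # x)"
        using x v u 2 sym2 n aff_act_gen_comm[OF n u(2) v(2) 2(2)]
        by (intro wall_folding.Cons beyond_wall_comm) auto
      moreover have "([i, j] @ x, [j, i] @ x) \<in> word_rel n"
        using 2 u v x by (intro word_rel.append word_rel.comm word_rel.refl)
      ultimately show ?thesis
        using word_rel_Cons[OF u(2) IHi] word_rel_Cons[OF v(2) IHj] u(1) v(1)
        by (metis append_Cons append_Nil word_rel.trans)
    next
      case 3
      then have sym3: "cyc_adj n j i" using cyc_adj_sym by blast
      obtain x where x: "x \<in> lists {..<n}"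
        "wall_folding n (aff_act_gen n i (aff_act_gen n j (aff_act_gen n i c))) x"
        using wall_folding_exists regular_aff_act_gen reg u v n by meson
      have "wall_folding n (aff_act_gen n i c) (j # i # x)"
        using x v u 3 n by (intro wall_folding.Cons beyond_wall_braid)
      moreover have "wall_folding n (aff_act_gen n j c) (i # j # x)"
        using x v u sym3 n by (intro wall_folding.Cons beyond_wall_braid)
          (auto simp: aff_act_gen_braid'[OF sym3])
      moreover have "([i, j, i] @ x, [j, i, j] @ x) \<in> word_rel n"
        using 3 u v x n by (intro word_rel.append word_rel_braid word_rel.refl)
      ultimately show ?thesis
        using word_rel_Cons[OF u(2) IHi] word_rel_Cons[OF v(2) IHj] u(1) v(1)
        by (metis append_Cons append_Nil word_rel.trans)
    qed
  qed
qed

text \<open>By regularity the point is not on wall \<open>i\<close>, so exactly one of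
  \<open>c\<close> and its reflection is beyond that wall, and a folding of that one may begin with
  \<open>i\<close>. Uniqueness of foldings compares it with the given one, and \<open>i\<close>
  cancels against itself where necessary.\<close>

lemma wall_folding_step:
  assumes "wall_folding n (aff_act_gen n i c) w" "wall_folding n c x" "regular n c" "i < n" "3 \<le> n"
  shows "(w, i # x) \<in> word_rel n"
proof (cases "beyond_wall n i c")
  case True
  have "(x, i # w) \<in> word_rel n"
    using assms True by (intro wall_folding_unique[of n c] wall_folding.Cons)
  then have "([i] @ x, [i] @ i # w) \<in> word_rel n"
    using assms by (intro word_rel.append word_rel.refl) auto
  moreover have "([i, i] @ w, [] @ w) \<in> word_rel n"
    using assms wall_folding_lists by (intro word_rel.append word_rel.refl word_rel.invol)
  ultimately show ?thesis by (auto intro: word_rel.sym word_rel.trans)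
next
  case False
  have "c (if i = 0 then 1 else i) - c (if i = 0 then n else i + 1) \<notin> \<int>"
    using assms unfolding regular_def by auto
  then have "c (if i = 0 then 1 else i) - c (if i = 0 then n else i + 1) \<noteq> (if i = 0 then 1 else 0)"
    by (metis Ints_0 Ints_1)
  then have "beyond_wall n i (aff_act_gen n i c)"
    using False assms by (auto simp: beyond_wall_def aff_act_gen_def split: if_splits)
  then have "wall_folding n (aff_act_gen n i c) (i # x)"
    using assms by (intro wall_folding.Cons) (auto simp: aff_act_gen_invol)
  then show ?thesis
    using assms by (intro wall_folding_unique[of n "aff_act_gen n i c"] regular_aff_act_gen)
qed

lemma wall_folding_alcove_pt: "3 \<le> n \<Longrightarrow> wall_folding n (alcove_pt n) []"
proof (rule wall_folding.Nil)
  fix i assume "3 \<le> n" "i < n"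
  then show "\<not> beyond_wall n i (alcove_pt n)"
    using alcove_pt_diff_bounds(1)[of i n "i + 1"] alcove_pt_diff_bounds(2)[of 1 n n]
    by (cases "i = 0") (simp_all add: beyond_wall_def)
qed

text \<open>Folding the image of \<open>alcove_pt\<close> reads the word back up to the relations:
  \<open>alcove_pt\<close> itself folds by the empty word, and \<open>wall_folding_step\<close> adds
  one letter at a time.\<close>

lemma wall_folding_wact:
  assumes "u \<in> lists {..<n}" "wall_folding n (wact n u (alcove_pt n)) w" "3 \<le> n"
  shows "(w, u) \<in> word_rel n"
  using assms
proof (induction u arbitrary: w)
  case Nil
  then show ?case
    using wall_folding_unique[OF _ wall_folding_alcove_pt regular_alcove_pt] by simp
next
  case (Cons i u)
  then have i: "i < n" and u: "u \<in> lists {..<n}" by auto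
  have reg: "regular n (wact n u (alcove_pt n))"
    using Cons u by (intro regular_wact regular_alcove_pt)
  then obtain x where x: "wall_folding n (wact n u (alcove_pt n)) x"
    using wall_folding_exists Cons by blast
  then have "(i # x, i # u) \<in> word_rel n"
    using Cons u i by (intro word_rel_Cons) auto
  moreover have "(w, i # x) \<in> word_rel n"
    using Cons x reg i by (intro wall_folding_step) auto
  ultimately show ?case by (rule word_rel.trans[rotated])
qed

text \<open>One folding of the common image is congruent to both words.\<close>

lemma wact_faithful:
  assumes "u \<in> lists {..<n}" "v \<in> lists {..<n}" "3 \<le> n"
    and "wact n u (alcove_pt n) = wact n v (alcove_pt n)"
  shows "(u, v) \<in> word_rel n"
proof -
  obtain w where "wall_folding n (wact n u (alcove_pt n)) w"
    using assms wall_folding_exists regular_wact regular_alcove_pt by meson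
  then have "(w, u) \<in> word_rel n" "(w, v) \<in> word_rel n"
    using wall_folding_wact assms by auto
  then show ?thesis by (blast intro: word_rel.sym word_rel.trans)
qed

section \<open>Translations\<close>

lemma sum_fun_apply: "(\<Sum>a\<in>A. f a) k = (\<Sum>a\<in>A. f a k)"
  by (induction A rule: infinite_finite_induct) auto

lemma sum_closed:
  fixes T :: "'a::comm_monoid_add set"
  assumes "0 \<in> T" "\<And>x y. x \<in> T \<Longrightarrow> y \<in> T \<Longrightarrow> x + y \<in> T" "\<And>a. a \<in> A \<Longrightarrow> f a \<in> T"
  shows "sum f A \<in> T"
  using assms(3) by (induction A rule: infinite_finite_induct) (auto intro: assms)

text \<open>The hypotheses on \<open>T\<close> describe an additive subgroup. It is applied to the
  vectors realised as translations and to the integer vectors of sum zero on a block.\<close>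

lemma int_span_subset:
  assumes "A \<subseteq> T" "0 \<in> T" "\<And>x y. x \<in> T \<Longrightarrow> y \<in> T \<Longrightarrow> x + y \<in> T" "\<And>x. x \<in> T \<Longrightarrow> - x \<in> T"
  shows "int_span A \<subseteq> T"
proof -
  have nat: "scal (of_nat k) x \<in> T" if "x \<in> T" for k x
  proof (induction k)
    case 0
    have "scal (of_nat 0) x = 0" by (auto simp: scal_def)
    then show ?case using assms(2) by (simp only:)
  next
    case (Suc k)
    have "scal (of_nat (Suc k)) x = x + scal (of_nat k) x"
      by (auto simp: scal_def algebra_simps)
    then show ?case using assms(3)[OF that Suc] by (simp only:)
  qed
  have "scal (of_int z) x \<in> T" if "x \<in> T" for z x
  proof (cases z)
    case (nonneg k)
    then show ?thesis using nat that by simp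
  next
    case (neg k)
    then have "of_int z = - (of_nat (Suc k) :: real)" by simp
    then have "scal (of_int z) x = - scal (of_nat (Suc k)) x"
      by (simp only: scal_def fun_eq_iff mult_minus_left uminus_apply) simp
    then show ?thesis using assms(4)[OF nat[OF that]] by (simp only:)
  qed
  then show ?thesis
    unfolding int_span_def using assms by (auto intro!: sum_closed)
qed

lemma int_span_zero: "0 \<in> int_span A"
  unfolding int_span_def
  by (auto intro!: exI[of _ "\<lambda>_. 0"] simp: scal_def zero_fun_def[symmetric])

lemma int_span_add:
  assumes "x \<in> int_span A" "y \<in> int_span A" shows "x + y \<in> int_span A"
proof -
  obtain f g where "x = (\<Sum>\<alpha>\<in>A. scal (of_int (f \<alpha>)) \<alpha>)" "y = (\<Sum>\<alpha>\<in>A. scal (of_int (g \<alpha>)) \<alpha>)"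
    using assms by (auto simp: int_span_def)
  then have "x + y = (\<Sum>\<alpha>\<in>A. scal (of_int (f \<alpha> + g \<alpha>)) \<alpha>)"
    by (auto simp: scal_def sum.distrib[symmetric] algebra_simps intro!: sum.cong)
  then show ?thesis
    unfolding int_span_def by (intro CollectI exI[of _ "\<lambda>\<alpha>. f \<alpha> + g \<alpha>"] conjI TrueI)
qed

lemma int_span_base:
  assumes "finite A" "\<alpha> \<in> A" shows "\<alpha> \<in> int_span A"
proof -
  have "\<alpha> = (\<Sum>\<beta>\<in>A. if \<beta> = \<alpha> then \<beta> else 0)" using assms by simp
  also have "\<dots> = (\<Sum>\<beta>\<in>A. scal (of_int (if \<beta> = \<alpha> then 1 else 0)) \<beta>)"
    by (auto simp: scal_def intro!: sum.cong)
  finally show ?thesis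
    unfolding int_span_def by (intro CollectI exI[of _ "\<lambda>\<beta>. if \<beta> = \<alpha> then 1 else 0"]) simp
qed

lemma real_span_scal_base:
  assumes "finite A" "\<alpha> \<in> A" shows "scal r \<alpha> \<in> real_span A"
proof -
  have "scal r \<alpha> = (\<Sum>\<beta>\<in>A. if \<beta> = \<alpha> then scal r \<beta> else 0)" using assms by simp
  also have "\<dots> = (\<Sum>\<beta>\<in>A. scal (if \<beta> = \<alpha> then r else 0) \<beta>)"
    by (auto simp: scal_def intro!: sum.cong)
  finally show ?thesis
    unfolding real_span_def by (intro CollectI exI[of _ "\<lambda>\<beta>. if \<beta> = \<alpha> then r else 0"]) simp
qed

lemma real_span_zero: "0 \<in> real_span A"
  unfolding real_span_def
  by (auto intro!: exI[of _ "\<lambda>_. 0"] simp: scal_def zero_fun_def[symmetric])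

lemma real_span_add:
  assumes "x \<in> real_span A" "y \<in> real_span A" shows "x + y \<in> real_span A"
proof -
  obtain f g where "x = (\<Sum>\<alpha>\<in>A. scal (f \<alpha>) \<alpha>)" "y = (\<Sum>\<alpha>\<in>A. scal (g \<alpha>) \<alpha>)"
    using assms by (auto simp: real_span_def)
  then have "x + y = (\<Sum>\<alpha>\<in>A. scal (f \<alpha> + g \<alpha>) \<alpha>)"
    by (auto simp: scal_def sum.distrib[symmetric] algebra_simps intro!: sum.cong)
  then show ?thesis
    unfolding real_span_def by (intro CollectI exI[of _ "\<lambda>\<alpha>. f \<alpha> + g \<alpha>"] conjI TrueI)
qed

lemma finite_roots: "finite (roots n)"
proof -
  have "roots n \<subseteq> (\<lambda>(i, j). evec i - evec j) ` ({1..n} \<times> {1..n})"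
    by (auto simp: roots_def)
  then show ?thesis by (rule finite_subset) simp
qed

lemma roots_P_subset: "m \<le> n \<Longrightarrow> roots_P n m \<subseteq> roots n"
  unfolding roots_P_def roots_def by fastforce

text \<open>\<open>transl\<close> constrains the action on \<open>V n\<close> only, so the point at
  which faithfulness is known has to lie there.\<close>

lemma alcove_pt_in_V: "alcove_pt n \<in> V n"
proof -
  \<comment> \<open>The coefficient of the k-th simple root is the partial sum of the first k
    coordinates of \<open>alcove_pt\<close>.\<close>
  define b where "b k = real k * (real n - real k) / (2 * real n)" for k
  have "(\<Sum>k\<in>{1..<n}. scal (b k) (simple_root k)) \<in> V n"
    unfolding V_def
  proof (intro sum_closed real_span_zero real_span_add)
    fix k assume "k \<in> {1..<n}"
    then have "simple_root k \<in> roots n"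
      unfolding simple_root_def roots_def by force
    then show "scal (b k) (simple_root k) \<in> real_span (roots n)"
      by (intro real_span_scal_base finite_roots)
  qed
  also have "(\<Sum>k\<in>{1..<n}. scal (b k) (simple_root k)) = alcove_pt n"
  proof
    fix j
    have "(\<Sum>k\<in>{1..<n}. scal (b k) (simple_root k)) j
      = (\<Sum>k\<in>{1..<n}. (if k = j then b k else 0) - (if k = j - 1 then if j = 0 then 0 else b k else 0))"
      unfolding sum_fun_apply
      by (intro sum.cong) (auto simp: scal_def simple_root_def evec_def)
    also have "\<dots> = (if j \<in> {1..<n} then b j else 0) - (if j - 1 \<in> {1..<n} then b (j - 1) else 0)"
      unfolding sum_subtractf by (auto simp: sum.delta)
    also have "\<dots> = alcove_pt n j"
    proof -
      \<comment> \<open>Vanishing at both ends makes the difference formula uniform, including j = 1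
        and j = n.\<close>
      have "b 0 = 0" "b n = 0" by (simp_all add: b_def)
      then have "(if j \<in> {1..<n} then b j else 0) - (if j - 1 \<in> {1..<n} then b (j - 1) else 0)
        = (if j \<in> {1..n} then b j - b (j - 1) else 0)"
        by (auto simp: not_less not_le le_Suc_eq dest!: le_antisym)
      also have "\<dots> = alcove_pt n j"
        by (auto simp: alcove_pt_def b_def of_nat_diff field_simps)
      finally show ?thesis .
    qed
    finally show "(\<Sum>k\<in>{1..<n}. scal (b k) (simple_root k)) j = alcove_pt n j" .
  qed
  finally show ?thesis .
qed

text \<open>The given word supplies existence in the definite description. Any competitor agrees
  with it at \<open>alcove_pt\<close>, which lies in \<open>V n\<close>, and faithfulness makes the
  classes equal.\<close>

lemma transl_eqI:
  assumes "u \<in> lists {..<n}" "3 \<le> n" "\<And>c. wact n u c = c + l"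
  shows "transl n l = wcls n u"
  unfolding transl_def
proof (rule the_equality)
  show "wcls n u \<in> carrier (aff_sym n) \<and> (\<forall>c\<in>V n. aff_act n (wcls n u) c = c + l)"
    using assms by (auto simp: carrier_aff_sym aff_act_wcls)
next
  fix w assume w: "w \<in> carrier (aff_sym n) \<and> (\<forall>c\<in>V n. aff_act n w c = c + l)"
  then obtain v where v: "v \<in> lists {..<n}" "w = wcls n v" by (auto simp: carrier_aff_sym)
  then have "wact n v (alcove_pt n) = wact n u (alcove_pt n)"
    using w alcove_pt_in_V assms by (metis aff_act_wcls)
  then show "w = wcls n u"
    using v assms wact_faithful by (simp only: wcls_eq_iff)
qed

text \<open>The condition ranges over all \<open>c\<close>, not just \<open>V n\<close>, so words
  can be composed, inverted and conjugated without tracking membership in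
  \<open>V n\<close>.\<close>

definition transl_vecs :: "nat \<Rightarrow> (nat \<Rightarrow> real) set" where
  "transl_vecs n = {l. \<exists>u\<in>lists {..<n}. \<forall>c. wact n u c = c + l}"

lemma transl_vecs_zero: "0 \<in> transl_vecs n"
  by (auto simp: transl_vecs_def intro: bexI[of _ "[]"])

lemma transl_vecs_add:
  assumes "l \<in> transl_vecs n" "l' \<in> transl_vecs n" shows "l + l' \<in> transl_vecs n"
proof -
  obtain u v where "u \<in> lists {..<n}" "\<forall>c. wact n u c = c + l"
    "v \<in> lists {..<n}" "\<forall>c. wact n v c = c + l'"
    using assms unfolding transl_vecs_def by blast
  then show ?thesis
    unfolding transl_vecs_def
    by (intro CollectI bexI[of _ "u @ v"]) (auto simp: algebra_simps)
qed

lemma transl_vecs_uminus: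
  assumes "l \<in> transl_vecs n" "3 \<le> n" shows "- l \<in> transl_vecs n"
proof -
  obtain u where u: "u \<in> lists {..<n}" "\<And>c. wact n u c = c + l"
    using assms unfolding transl_vecs_def by blast
  have "wact n (rev u) c = c + - l" for c
    using wact_rev[OF u(1) assms(2), of "c - l"] by (simp add: u(2))
  moreover have "rev u \<in> lists {..<n}" using u by (simp add: in_lists_conv_set)
  ultimately show ?thesis unfolding transl_vecs_def by blast
qed

text \<open>Induction on \<open>b\<close> by conjugation: the transposition (a, b+1) is
  \<open>s_b\<close> (a, b) \<open>s_b\<close>.\<close>

lemma transpose_word:
  assumes "1 \<le> a" "a < b" "b \<le> n"
  shows "\<exists>t\<in>lists {..<n}. \<forall>c. wact n t c = c \<circ> transpose a b"
  using assms(2,3)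
proof (induction b)
  case (Suc b)
  show ?case
  proof (cases "a = b")
    case True
    then show ?thesis
      using assms(1) Suc.prems by (intro bexI[of _ "[b]"]) (auto simp: aff_act_gen_def)
  next
    case False
    then obtain t where t: "t \<in> lists {..<n}" "\<And>c. wact n t c = c \<circ> transpose a b"
      using Suc.IH Suc.prems by (metis Suc_leD less_SucE)
    have "wact n ([b] @ t @ [b]) c = c \<circ> transpose a (Suc b)" for c
      using assms(1) Suc.prems False
      by (simp add: t(2) aff_act_gen_def) (auto simp: fun_eq_iff transpose_def)
    moreover have "[b] @ t @ [b] \<in> lists {..<n}" using t Suc.prems by simp
    ultimately show ?thesis by blast
  qed
qed simp

text \<open>Conjugating a translation by a transposition gives the translation by the permuted
  vector.\<close>

lemma transl_vecs_transpose:
  assumes "l \<in> transl_vecs n" "1 \<le> a" "a < b" "b \<le> n"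
  shows "l \<circ> transpose a b \<in> transl_vecs n"
proof -
  obtain u where u: "u \<in> lists {..<n}" "\<And>c. wact n u c = c + l"
    using assms unfolding transl_vecs_def by blast
  obtain t where t: "t \<in> lists {..<n}" "\<And>c. wact n t c = c \<circ> transpose a b"
    using transpose_word[OF assms(2-4)] by blast
  have "wact n (t @ u @ t) c = c + (l \<circ> transpose a b)" for c
  proof -
    have "wact n (t @ u @ t) c = wact n t (wact n u (wact n t c))" by simp
    also have "\<dots> = ((c \<circ> transpose a b) + l) \<circ> transpose a b" by (simp only: u(2) t(2))
    also have "\<dots> = c + (l \<circ> transpose a b)" by (simp add: fun_eq_iff)
    finally show ?thesis .
  qed
  moreover have "t @ u @ t \<in> lists {..<n}" using u t by simp
  ultimately show ?thesis unfolding transl_vecs_def by blast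
qed

text \<open>\<open>s_0\<close> is the reflection with linear part (1 n), so following that
  transposition by \<open>s_0\<close> leaves only the shift.\<close>

lemma theta_in_transl_vecs:
  assumes "3 \<le> n" shows "theta n \<in> transl_vecs n"
proof -
  obtain t where t: "t \<in> lists {..<n}" "\<And>c. wact n t c = c \<circ> transpose 1 n"
    using transpose_word[of 1 n n] assms by force
  have "wact n (0 # t) c = c + theta n" for c
    using assms by (auto simp: t(2) aff_act_gen_def theta_def evec_def fun_eq_iff transpose_def)
  moreover have "0 # t \<in> lists {..<n}" using t assms by simp
  ultimately show ?thesis unfolding transl_vecs_def by blast
qed

text \<open>Transposing b and n carries \<theta> to e_1 - e_b, and differences of such vectors yield
  all roots.\<close>

lemma roots_subset_transl_vecs:
  assumes "3 \<le> n" shows "roots n \<subseteq> transl_vecs n"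
proof -
  have 1: "evec 1 - evec b \<in> transl_vecs n" if b: "b \<in> {1..n}" for b
  proof -
    consider "b = 1" | "b = n" | "1 < b" "b < n" using b by fastforce
    then show ?thesis
    proof cases
      case 1
      then show ?thesis using transl_vecs_zero by simp
    next
      case 2
      then show ?thesis using theta_in_transl_vecs[OF assms] by (simp add: theta_def)
    next
      case 3
      have "evec 1 - evec b = theta n \<circ> transpose b n"
        using 3 by (auto simp: theta_def evec_def fun_eq_iff transpose_def)
      then show ?thesis
        using transl_vecs_transpose[OF theta_in_transl_vecs[OF assms]] 3 by simp
    qed
  qed
  have "evec a - evec b \<in> transl_vecs n" if "a \<in> {1..n}" "b \<in> {1..n}" for a b
  proof -
    have "(evec 1 - evec b) + - (evec 1 - evec a) \<in> transl_vecs n"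
      using that assms 1 by (intro transl_vecs_add transl_vecs_uminus)
    then show ?thesis by (simp add: algebra_simps)
  qed
  then show ?thesis by (auto simp: roots_def)
qed

lemma translation_word:
  assumes "A \<subseteq> roots n" "l \<in> int_span A" "3 \<le> n"
  obtains u where "u \<in> lists {..<n}" "\<And>c. wact n u c = c + l"
proof -
  have "int_span A \<subseteq> transl_vecs n"
    using assms roots_subset_transl_vecs[of n]
    by (intro int_span_subset transl_vecs_zero transl_vecs_add transl_vecs_uminus) auto
  then have "l \<in> transl_vecs n" using assms(2) by blast
  then show ?thesis using that unfolding transl_vecs_def by blast
qed

section \<open>Affine roots as affine functions\<close>

text \<open>Here \<delta> becomes the constant function 1, so \<alpha>_0 is 1 - (c_1 - c_n) and the
  simple affine roots are the functions cutting out the fundamental alcove.\<close>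

definition root_eval :: "nat \<Rightarrow> aff_vec \<Rightarrow> (nat \<Rightarrow> real) \<Rightarrow> real" where
  "root_eval n b c = (\<Sum>k=1..n. fst b k * c k) + of_int (snd b)"

lemma root_eval_zero: "root_eval n 0 c = 0"
  by (simp add: root_eval_def)

lemma root_eval_add: "root_eval n (b + b') c = root_eval n b c + root_eval n b' c"
  by (simp add: root_eval_def algebra_simps sum.distrib)

lemma root_eval_uminus: "root_eval n (- b) c = - root_eval n b c"
  by (simp add: root_eval_def sum_negf)

lemma root_eval_scal: "root_eval n (aff_scal a b) c = of_int a * root_eval n b c"
  by (simp add: root_eval_def aff_scal_def scal_def algebra_simps sum_distrib_left)

lemma root_eval_sum: "root_eval n (\<Sum>i\<in>A. f i) c = (\<Sum>i\<in>A. root_eval n (f i) c)"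
  by (induction A rule: infinite_finite_induct) (auto simp: root_eval_zero root_eval_add)

lemma evec_sum: "a \<in> {1..n} \<Longrightarrow> (\<Sum>k=1..n. evec a k * c k) = c a"
proof -
  assume "a \<in> {1..n}"
  moreover have "(\<Sum>k=1..n. evec a k * c k) = (\<Sum>k=1..n. if k = a then c k else 0)"
    by (intro sum.cong) (auto simp: evec_def)
  ultimately show ?thesis by simp
qed

lemma root_eval_root:
  assumes "a \<in> {1..n}" "b \<in> {1..n}"
  shows "root_eval n (evec a - evec b, p) c = c a - c b + of_int p"
  using evec_sum[OF assms(1), of c] evec_sum[OF assms(2), of c]
  by (simp add: root_eval_def algebra_simps sum_subtractf)

lemma root_eval_simple:
  assumes "i < n"
  shows "root_eval n (aff_simple_root n i) c = (if i = 0 then 1 + c n - c 1 else c i - c (i + 1))"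
proof (cases "i = 0")
  case True
  have "aff_simple_root n 0 = (evec n - evec 1, 1)"
    by (simp add: aff_simple_root_def theta_def)
  then show ?thesis using True assms by (simp add: root_eval_root)
next
  case False
  have "aff_simple_root n i = (evec i - evec (i + 1), 0)"
    using False by (simp add: aff_simple_root_def simple_root_def)
  then show ?thesis using False assms root_eval_root[of i n "i + 1" 0 c] by simp
qed

text \<open>Matches the level-zero action with the affine action on the basis of simple affine
  roots. As \<open>s_j\<close> is an involution, acting by it is precomposition with
  \<open>s_j\<close> itself.\<close>

lemma root_eval_lz_simple:
  assumes "i < n" "j < n" "3 \<le> n"
  shows "root_eval n (lz_simple n j i) c = root_eval n (aff_simple_root n i) (aff_act_gen n j c)"
proof -
  have adj: "cyc_adj n i j \<longleftrightarrow> i = j + 1 \<or> j = i + 1 \<or> i = 0 \<and> j + 1 = n \<or> j = 0 \<and> i + 1 = n"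
    using assms by (rule cyc_adj_iff)
  show ?thesis
    unfolding lz_simple_def adj root_eval_simple[OF assms(1)] using assms
    by (auto simp: root_eval_add root_eval_uminus root_eval_simple aff_act_gen_def transpose_def)
qed

text \<open>The value at 0 gives the coefficient of \<delta>, and the values at the unit vectors
  then give the coordinates. The support hypotheses cover the indices that evaluation does not
  see.\<close>

lemma root_eval_ext:
  assumes "\<And>c. root_eval n b c = root_eval n b' c"
    and "\<And>k. k \<notin> {1..n} \<Longrightarrow> fst b k = 0" "\<And>k. k \<notin> {1..n} \<Longrightarrow> fst b' k = 0"
  shows "b = b'"
proof (rule prod_eqI)
  show snd: "snd b = snd b'" using assms(1)[of 0] by (simp add: root_eval_def)
  show "fst b = fst b'"
  proof
    fix k
    show "fst b k = fst b' k"
    proof (cases "k \<in> {1..n}")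
      case True
      then have "root_eval n x (evec k) = fst x k + of_int (snd x)" for x
        using evec_sum[of k n "fst x"] by (simp add: root_eval_def mult.commute)
      then show ?thesis using assms(1)[of "evec k"] snd by simp
    qed (simp add: assms)
  qed
qed

section \<open>Coordinates in the simple affine roots and the level-zero action of words\<close>

lemma aff_root_supp:
  assumes "b \<in> aff_roots n" "k \<notin> {1..n}" shows "fst b k = 0"
  using assms by (auto simp: aff_roots_def roots_def evec_def)

lemma aff_simple_root_supp:
  assumes "i < n" "k \<notin> {1..n}" shows "fst (aff_simple_root n i) k = 0"
  using assms by (auto simp: aff_simple_root_def theta_def simple_root_def evec_def)

lemma lz_simple_supp:
  assumes "i < n" "j < n" "k \<notin> {1..n}" shows "fst (lz_simple n j i) k = 0"
  using aff_simple_root_supp[OF assms(1,3)] aff_simple_root_supp[OF assms(2,3)]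
  by (simp add: lz_simple_def)

lemma aff_comb_supp:
  assumes "\<And>i. i \<in> A \<Longrightarrow> fst (f i) k = 0" shows "fst (\<Sum>i\<in>A. aff_scal (a i) (f i)) k = 0"
  using assms by (simp add: fst_sum sum_fun_apply aff_scal_def scal_def)

text \<open>The points e_1 + ... + e_k, with 0 for k = 0, are dual to the simple affine roots.
  Evaluating there reads off single coefficients, which proves uniqueness in
  \<open>aff_coords\<close>.\<close>

lemma aff_simple_root_dual:
  assumes "i < n" "k < n"
  shows "root_eval n (aff_simple_root n i) (\<lambda>j. if 1 \<le> j \<and> j \<le> k then 1 else 0) = (if i = k then 1 else 0)"
  using assms by (auto simp: root_eval_simple)

lemma aff_coords_eqI:
  assumes "\<And>i. i \<ge> n \<Longrightarrow> a i = 0" "b = (\<Sum>i<n. aff_scal (a i) (aff_simple_root n i))"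
  shows "aff_coords n b = a"
  unfolding aff_coords_def
proof (rule the_equality)
  show "(\<forall>i\<ge>n. a i = 0) \<and> b = (\<Sum>i<n. aff_scal (a i) (aff_simple_root n i))"
    using assms by blast
next
  fix a' assume a': "(\<forall>i\<ge>n. a' i = 0) \<and> b = (\<Sum>i<n. aff_scal (a' i) (aff_simple_root n i))"
  have coeff: "root_eval n (\<Sum>i<n. aff_scal (x i) (aff_simple_root n i))
    (\<lambda>j. if 1 \<le> j \<and> j \<le> k then 1 else 0) = of_int (x k)" if "k < n" for x k
  proof -
    have "root_eval n (\<Sum>i<n. aff_scal (x i) (aff_simple_root n i))
      (\<lambda>j. if 1 \<le> j \<and> j \<le> k then 1 else 0) = (\<Sum>i<n. if i = k then of_int (x i) else 0)"
      unfolding root_eval_sum root_eval_scal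
      by (intro sum.cong HOL.refl) (subst aff_simple_root_dual[OF _ that], auto)
    then show ?thesis using that by simp
  qed
  show "a' = a"
  proof
    fix k
    show "a' k = a k"
    proof (cases "k < n")
      case True
      have "(of_int (a' k) :: real) = of_int (a k)"
        using coeff[OF True, of a'] coeff[OF True, of a] a' assms(2) by simp
      then show ?thesis by simp
    qed (use a' assms(1) in simp)
  qed
qed

text \<open>Telescoping of \<alpha>_a + ... + \<alpha>_(n-1).\<close>

lemma sum_simple_from:
  assumes "a \<le> n" "1 \<le> a"
  shows "(\<Sum>i<n. if a \<le> i then root_eval n (aff_simple_root n i) c else 0) = c a - c n"
proof -
  have "(\<Sum>i<n. if a \<le> i then root_eval n (aff_simple_root n i) c else 0)
    = (\<Sum>i\<in>{a..<n}. root_eval n (aff_simple_root n i) c)"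
    by (rule sum.mono_neutral_cong_right) auto
  also have "\<dots> = (\<Sum>i\<in>{a..<n}. - c (Suc i) - - c i)"
    using assms by (intro sum.cong) (auto simp: root_eval_simple)
  also have "\<dots> = c a - c n"
    by (subst sum_Suc_diff'[OF assms(1)]) simp
  finally show ?thesis .
qed

text \<open>Write e_a - e_b as (e_a - e_n) - (e_b - e_n) and telescope each part. The summand
  \<open>p\<close> occurs in every coefficient because \<delta> is the sum of all simple affine
  roots, shown here as the identity \<open>total\<close>.\<close>

lemma aff_root_expansion:
  assumes "a \<in> {1..n}" "b \<in> {1..n}"
  shows "(evec a - evec b, p) =
    (\<Sum>i<n. aff_scal (p + (if a \<le> i then 1 else 0) - (if b \<le> i then 1 else 0)) (aff_simple_root n i))"
    (is "_ = ?s")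
proof (rule root_eval_ext)
  fix c
  let ?g = "\<lambda>i. root_eval n (aff_simple_root n i) c"
  have "(\<Sum>i<n. ?g i) = ?g 0 + (\<Sum>i<n. if 1 \<le> i then ?g i else 0)"
  proof -
    have "n > 0" using assms by auto
    have "(\<Sum>i<n. ?g i) = (\<Sum>i<n. (if i = 0 then ?g i else 0) + (if 1 \<le> i then ?g i else 0))"
      by (intro sum.cong) auto
    then show ?thesis using \<open>n > 0\<close> by (simp add: sum.distrib)
  qed
  also have "\<dots> = 1"
    using sum_simple_from[of 1 n c] assms by (simp add: root_eval_simple)
  finally have total: "(\<Sum>i<n. ?g i) = 1" .
  have "root_eval n ?s c = (\<Sum>i<n. of_int p * ?g i + (if a \<le> i then ?g i else 0) - (if b \<le> i then ?g i else 0))"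
    unfolding root_eval_sum root_eval_scal by (intro sum.cong) (auto simp: algebra_simps)
  also have "\<dots> = of_int p * (\<Sum>i<n. ?g i) + (c a - c n) - (c b - c n)"
    using sum_simple_from[of a n c] sum_simple_from[of b n c] assms
    by (simp add: sum_subtractf sum.distrib sum_distrib_left)
  finally show "root_eval n (evec a - evec b, p) c = root_eval n ?s c"
    using assms by (simp add: total root_eval_root)
next
  fix k assume "k \<notin> {1..n}"
  then show "fst (evec a - evec b, p) k = 0" using assms by (auto simp: evec_def)
  show "fst ?s k = 0"
    using \<open>k \<notin> {1..n}\<close> by (intro aff_comb_supp aff_simple_root_supp) auto
qed

lemma aff_rootsE:
  assumes "b \<in> aff_roots n"
  obtains i j p where "b = (evec i - evec j, p)" "i \<in> {1..n}" "j \<in> {1..n}" "i \<noteq> j"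
  using assms by (auto simp: aff_roots_def roots_def)

lemma aff_rootsI: "i \<in> {1..n} \<Longrightarrow> j \<in> {1..n} \<Longrightarrow> i \<noteq> j \<Longrightarrow> (evec i - evec j, p) \<in> aff_roots n"
  by (auto simp: aff_roots_def roots_def)

lemma lz_gen_supp:
  assumes "j < n" "k \<notin> {1..n}" shows "fst (lz_gen n j b) k = 0"
  unfolding lz_gen_def using assms by (intro aff_comb_supp lz_simple_supp) auto

lemma root_eval_lz_gen:
  assumes "b \<in> aff_roots n" "j < n" "3 \<le> n"
  shows "root_eval n (lz_gen n j b) c = root_eval n b (aff_act_gen n j c)"
proof -
  obtain x y p where b: "b = (evec x - evec y, p)" "x \<in> {1..n}" "y \<in> {1..n}"
    using assms(1) by (rule aff_rootsE) (rule that)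
  define a :: "nat \<Rightarrow> int" where
    "a i = (if i < n then p + (if x \<le> i then 1 else 0) - (if y \<le> i then 1 else 0) else 0)" for i
  have exp: "b = (\<Sum>i<n. aff_scal (a i) (aff_simple_root n i))"
    unfolding b(1) aff_root_expansion[OF b(2,3)] by (intro sum.cong) (auto simp: a_def)
  have "aff_coords n b = a"
    by (rule aff_coords_eqI[OF _ exp]) (simp add: a_def)
  then have "root_eval n (lz_gen n j b) c
    = (\<Sum>i<n. of_int (a i) * root_eval n (aff_simple_root n i) (aff_act_gen n j c))"
    unfolding lz_gen_def root_eval_sum root_eval_scal
    using root_eval_lz_simple assms(2,3) by (intro sum.cong) auto
  also have "\<dots> = root_eval n b (aff_act_gen n j c)"
    unfolding exp root_eval_sum root_eval_scal ..
  finally show ?thesis .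
qed

text \<open>Precomposing c_x - c_y + p with a coordinate permutation and integer shifts gives a
  function of the same shape, and an affine vector is determined by its function.\<close>

lemma lz_gen_aff_roots:
  assumes "b \<in> aff_roots n" "j < n" "3 \<le> n"
  shows "lz_gen n j b \<in> aff_roots n"
proof -
  obtain x y p where b: "b = (evec x - evec y, p)" "x \<in> {1..n}" "y \<in> {1..n}" "x \<noteq> y"
    using assms(1) by (rule aff_rootsE) (rule that)
  obtain s z where c': "\<And>c k. aff_act_gen n j c k = c (s k) + of_int (z k)"
    and s: "\<And>k. k \<in> {1..n} \<Longrightarrow> s k \<in> {1..n}" and inj: "\<And>a b. a \<noteq> b \<Longrightarrow> s a \<noteq> s b"
    by (rule aff_act_gen_coords[OF assms(2,3)]) (rule that)
  have "lz_gen n j b = (evec (s x) - evec (s y), p + z x - z y)"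
  proof (rule root_eval_ext)
    show "root_eval n (lz_gen n j b) c = root_eval n (evec (s x) - evec (s y), p + z x - z y) c" for c
      unfolding root_eval_lz_gen[OF assms]
      by (simp add: b(1) root_eval_root[OF b(2,3)] root_eval_root[OF s[OF b(2)] s[OF b(3)]] c')
    show "fst (lz_gen n j b) k = 0" if "k \<notin> {1..n}" for k
      using assms(2) that by (rule lz_gen_supp)
    show "fst (evec (s x) - evec (s y), p + z x - z y) k = 0" if "k \<notin> {1..n}" for k
      using that s[OF b(2)] s[OF b(3)] by (auto simp: evec_def)
  qed
  then show ?thesis using aff_rootsI[OF s[OF b(2)] s[OF b(3)] inj[OF b(4)]] by simp
qed

text \<open>Precomposition reverses the order of the letters, whence \<open>rev u\<close>. Both
  claims share one induction because \<open>root_eval_lz_gen\<close> applies only to affine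
  roots.\<close>

lemma lz_word:
  assumes "u \<in> lists {..<n}" "b \<in> aff_roots n" "3 \<le> n"
  shows "foldr (lz_gen n) u b \<in> aff_roots n
    \<and> root_eval n (foldr (lz_gen n) u b) c = root_eval n b (wact n (rev u) c)"
  using assms(1)
proof (induction u arbitrary: c)
  case (Cons i u)
  then have "i < n" by auto
  then show ?case
    using Cons.IH assms(3) by (simp add: lz_gen_aff_roots root_eval_lz_gen)
qed (simp add: assms(2))

lemma lz_act_wcls:
  assumes "u \<in> lists {..<n}" "b \<in> aff_roots n" "3 \<le> n"
  shows "lz_act n (wcls n u) b = foldr (lz_gen n) u b"
proof -
  have "foldr (lz_gen n) v b = foldr (lz_gen n) u b" if "v \<in> wcls n u" for v
  proof (rule root_eval_ext)
    have v: "(u, v) \<in> word_rel n" "v \<in> lists {..<n}"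
      using that word_rel_lists by auto
    show "root_eval n (foldr (lz_gen n) v b) c = root_eval n (foldr (lz_gen n) u b) c" for c
      using lz_word[OF assms] lz_word[OF v(2) assms(2,3)]
        wact_word_rel[OF word_rel_rev[OF v(1)] assms(3)] by simp
    show "fst (foldr (lz_gen n) v b) k = 0" if "k \<notin> {1..n}" for k
      using lz_word[OF v(2) assms(2,3)] that aff_root_supp by blast
    show "fst (foldr (lz_gen n) u b) k = 0" if "k \<notin> {1..n}" for k
      using lz_word[OF assms] that aff_root_supp by blast
  qed
  then have "(\<lambda>v. foldr (lz_gen n) v b) ` wcls n u = (\<lambda>v. foldr (lz_gen n) u b) ` wcls n u"
    by (intro image_cong) auto
  also have "\<dots> = {foldr (lz_gen n) u b}"
    using equiv_class_self[OF equiv_word_rel assms(1)] by (rule image_constant)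
  finally show ?thesis by (simp add: lz_act_def)
qed

text \<open>Coordinates of \<open>alcove_pt\<close> decrease and differ by less than 1, so a nonzero
  \<open>p\<close> decides the sign and for p = 0 the order of the indices does.\<close>

lemma root_eval_alcove_pt_pos:
  assumes "i \<in> {1..n}" "j \<in> {1..n}" "i \<noteq> j"
  shows "root_eval n (evec i - evec j, p) (alcove_pt n) > 0 \<longleftrightarrow> p > 0 \<or> p = 0 \<and> i < j"
proof -
  have "\<bar>alcove_pt n i - alcove_pt n j\<bar> < 1" "alcove_pt n i - alcove_pt n j > 0 \<longleftrightarrow> i < j"
    using assms alcove_pt_diff_bounds[of i n j] alcove_pt_diff_bounds[of j n i]
    by (cases "i < j"; simp)+
  moreover have "of_int p \<ge> (1::real) \<or> p = 0 \<or> of_int p \<le> (-1::real)"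
    by (cases "p > 0"; cases "p = 0") auto
  ultimately show ?thesis
    using assms by (auto simp: root_eval_root)
qed

lemma pos_aff_roots_iff:
  assumes "b \<in> aff_roots n"
  shows "b \<in> pos_aff_roots n \<longleftrightarrow> root_eval n b (alcove_pt n) > 0"
proof -
  note eval = root_eval_alcove_pt_pos
  show ?thesis
  proof
    assume "b \<in> pos_aff_roots n"
    then obtain i j p where "b = (evec i - evec j, p)" "i \<in> {1..n}" "j \<in> {1..n}" "i \<noteq> j"
      "p > 0 \<or> p = 0 \<and> i < j"
      by (auto simp: pos_aff_roots_def roots_def pos_roots_def)
    then show "root_eval n b (alcove_pt n) > 0" using eval by simp
  next
    assume "root_eval n b (alcove_pt n) > 0"
    moreover obtain i j p where b: "b = (evec i - evec j, p)" "i \<in> {1..n}" "j \<in> {1..n}" "i \<noteq> j"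
      using assms by (rule aff_rootsE) (rule that)
    ultimately have "p > 0 \<or> p = 0 \<and> i < j" using eval by simp
    then show "b \<in> pos_aff_roots n"
      using b by (auto simp: pos_aff_roots_def roots_def pos_roots_def)
  qed
qed

section \<open>Parabolic alcoves\<close>

definition in_alcove :: "nat set \<Rightarrow> (nat \<Rightarrow> real) \<Rightarrow> bool" where
  "in_alcove B y \<longleftrightarrow> (\<forall>a\<in>B. \<forall>b\<in>B. a < b \<longrightarrow> 0 < y a - y b \<and> y a - y b < 1)"

text \<open>For a < b in one block, the roots \<alpha> = e_a - e_b and \<delta> - \<alpha> give the
  lower and the upper bound on the coordinate difference. All other positive roots over \<alpha> and
  -\<alpha> add nonnegative multiples of \<delta> and follow from these two.\<close>

lemma upper_P_iff:
  assumes "u \<in> lists {..<n}" "3 \<le> n" "m \<le> n"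
  shows "wcls n u \<in> aff_sym_upper_P n m \<longleftrightarrow>
    in_alcove {1..m} (wact n (rev u) (alcove_pt n)) \<and> in_alcove {m + 1..n} (wact n (rev u) (alcove_pt n))"
    (is "_ \<longleftrightarrow> in_alcove _ ?y \<and> in_alcove _ ?y")
proof -
  have carrier: "wcls n u \<in> carrier (aff_sym n)"
    using assms(1) unfolding carrier_aff_sym by blast
  have pos: "lz_act n (wcls n u) (evec i - evec j, p) \<in> pos_aff_roots n \<longleftrightarrow> ?y i - ?y j + of_int p > 0"
    if "i \<in> {1..n}" "j \<in> {1..n}" "i \<noteq> j" for i j p
    using pos_aff_roots_iff lz_word[OF assms(1) aff_rootsI[OF that] assms(2)]
      lz_act_wcls[OF assms(1) aff_rootsI[OF that] assms(2)] root_eval_root[OF that(1,2)]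
    by simp
  have in_pos: "(evec i - evec j, p) \<in> pos_aff_roots n \<longleftrightarrow> p > 0 \<or> p = 0 \<and> i < j"
    if "i \<in> {1..n}" "j \<in> {1..n}" "i \<noteq> j" for i j p
    unfolding pos_aff_roots_iff[OF aff_rootsI[OF that]] root_eval_alcove_pt_pos[OF that] ..
  show ?thesis
  proof
    assume up: "wcls n u \<in> aff_sym_upper_P n m"
    have *: "0 < ?y a - ?y b \<and> ?y a - ?y b < 1"
      if "a < b" "a \<in> {1..m} \<and> b \<in> {1..m} \<or> a \<in> {m + 1..n} \<and> b \<in> {m + 1..n}" for a b
    proof -
      have ab: "a \<in> {1..n}" "b \<in> {1..n}" "a \<noteq> b" using that assms(3) by auto
      have "evec a - evec b \<in> roots_P n m" "evec b - evec a \<in> roots_P n m"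
        unfolding roots_P_def using that ab(3) by blast+
      then have "(evec a - evec b, 0) \<in> pos_aff_roots_P n m" "(evec b - evec a, 1) \<in> pos_aff_roots_P n m"
        using in_pos ab that(1) by (auto simp: pos_aff_roots_P_def)
      then have "lz_act n (wcls n u) (evec a - evec b, 0) \<in> pos_aff_roots n"
        "lz_act n (wcls n u) (evec b - evec a, 1) \<in> pos_aff_roots n"
        using up by (auto simp: aff_sym_upper_P_def)
      then show ?thesis
        using pos[of a b 0] pos[of b a 1] ab by simp
    qed
    show "in_alcove {1..m} ?y \<and> in_alcove {m + 1..n} ?y"
      unfolding in_alcove_def using * by blast
  next
    assume alc: "in_alcove {1..m} ?y \<and> in_alcove {m + 1..n} ?y"
    have "lz_act n (wcls n u) b \<in> pos_aff_roots n" if b: "b \<in> pos_aff_roots_P n m" for b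
    proof -
      obtain \<alpha> p where b_eq: "b = (\<alpha>, p)" by (cases b)
      then have "\<alpha> \<in> roots_P n m" using b by (simp add: pos_aff_roots_P_def)
      then obtain i j where ij: "\<alpha> = evec i - evec j" "i \<noteq> j"
        "i \<in> {1..m} \<and> j \<in> {1..m} \<or> i \<in> {m + 1..n} \<and> j \<in> {m + 1..n}"
        unfolding roots_P_def by blast
      then have ij': "i \<in> {1..n}" "j \<in> {1..n}" using assms(3) by auto
      have p: "p > 0 \<or> p = 0 \<and> i < j"
        using b in_pos[OF ij' ij(2)] by (simp add: pos_aff_roots_P_def b_eq ij(1))
      have "i < j \<Longrightarrow> 0 < ?y i - ?y j \<and> ?y i - ?y j < 1" "j < i \<Longrightarrow> 0 < ?y j - ?y i \<and> ?y j - ?y i < 1"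
        using alc ij(3) unfolding in_alcove_def by blast+
      moreover have "p > 0 \<Longrightarrow> of_int p \<ge> (1::real)" by simp
      ultimately have "?y i - ?y j + of_int p > 0"
        using p ij(2) by (cases "i < j"; cases "p > 0") fastforce+
      then show ?thesis
        using pos[OF ij' ij(2)] by (simp add: b_eq ij(1))
    qed
    then show "wcls n u \<in> aff_sym_upper_P n m"
      using carrier by (simp add: aff_sym_upper_P_def)
  qed
qed

text \<open>Within each block, the elements of \<^const>\<open>aff_sym_lower_P\<close> permute the coordinates and add
  integers of sum zero; \<open>frac_equiv\<close> records the resulting invariants.\<close>

definition frac_equiv :: "nat set \<Rightarrow> (nat \<Rightarrow> real) \<Rightarrow> (nat \<Rightarrow> real) \<Rightarrow> bool" where
  "frac_equiv B y y' \<longleftrightarrow> (\<lambda>k. frac (y k)) ` B = (\<lambda>k. frac (y' k)) ` B \<and> sum y B = sum y' B"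

lemma frac_equiv_refl: "frac_equiv B y y"
  by (simp add: frac_equiv_def)

lemma frac_equiv_sym: "frac_equiv B y y' \<Longrightarrow> frac_equiv B y' y"
  by (simp add: frac_equiv_def)

lemma frac_equiv_trans: "frac_equiv B y y' \<Longrightarrow> frac_equiv B y' y'' \<Longrightarrow> frac_equiv B y y''"
  by (simp add: frac_equiv_def)

lemma frac_equiv_add:
  assumes "\<And>k. l k \<in> \<int>" "sum l B = 0" shows "frac_equiv B y (y + l)"
  using assms by (simp add: frac_equiv_def frac_add_int_right sum.distrib)

lemma frac_equiv_transpose:
  assumes "a \<in> B \<longleftrightarrow> b \<in> B" shows "frac_equiv B y (y \<circ> transpose a b)"
proof -
  have img: "transpose a b ` B = B" using assms by (rule transpose_image_eq)
  have "(\<lambda>k. frac (y k)) ` (transpose a b ` B) = (\<lambda>k. frac ((y \<circ> transpose a b) k)) ` B"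
    by (simp only: image_image o_apply)
  moreover have "sum y (transpose a b ` B) = sum (y \<circ> transpose a b) B"
    by (rule sum.reindex) simp
  ultimately show ?thesis unfolding frac_equiv_def img by (rule conjI)
qed

text \<open>Strict monotonicity gives \<open>a \<le> s a\<close> throughout; since \<open>s\<close>
  permutes the interval, both sides have the same sum, which forces equality.\<close>

lemma strict_mono_on_interval_id:
  fixes s :: "nat \<Rightarrow> nat"
  assumes "s ` {p..q} = {p..q}" "\<And>a b. a \<in> {p..q} \<Longrightarrow> b \<in> {p..q} \<Longrightarrow> a < b \<Longrightarrow> s a < s b"
    and "a \<in> {p..q}"
  shows "s a = a"
proof -
  have ge: "a \<le> s a" if "a \<in> {p..q}" for a
    using that
  proof (induction a)
    case (Suc a)
    show ?case
    proof (cases "Suc a = p")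
      case True
      have "s (Suc a) \<in> {p..q}" using assms(1) Suc.prems by blast
      then show ?thesis using True by simp
    next
      case False
      then have "a \<in> {p..q}" using Suc.prems by auto
      then show ?thesis using Suc assms(2)[of a "Suc a"] by fastforce
    qed
  qed simp
  have inj: "inj_on s {p..q}" by (rule eq_card_imp_inj_on) (simp_all add: assms(1))
  have "sum id (s ` {p..q}) = sum (id \<circ> s) {p..q}" by (rule sum.reindex[OF inj])
  then have "sum id {p..q} = sum s {p..q}" by (simp add: assms(1))
  then have "id a = s a"
    by (rule sum_mono_inv) (use ge assms(3) in auto)
  then show ?thesis by simp
qed

text \<open>Coordinates with equal fractional parts are matched by a map \<open>s\<close>, with
  integer discrepancies \<open>k\<close>. The alcove bounds and the equal sums force
  \<open>k\<close> to vanish; then \<open>s\<close> preserves the order, since both points have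
  decreasing coordinates, and is the identity.\<close>

lemma in_alcove_unique:
  fixes p q :: nat
  assumes "in_alcove {p..q} y" "in_alcove {p..q} y'" "frac_equiv {p..q} y y'" "a \<in> {p..q}"
  shows "y a = y' a"
proof -
  let ?B = "{p..q}"
  have "\<forall>a\<in>?B. \<exists>b\<in>?B. frac (y' b) = frac (y a)"
  proof
    fix a assume "a \<in> ?B"
    then have "frac (y a) \<in> (\<lambda>k. frac (y k)) ` ?B" by (rule imageI)
    also have "\<dots> = (\<lambda>k. frac (y' k)) ` ?B" using assms(3) by (simp only: frac_equiv_def)
    finally show "\<exists>b\<in>?B. frac (y' b) = frac (y a)" by (auto simp only: image_iff)
  qed
  then obtain s where s_ball: "\<forall>a\<in>?B. s a \<in> ?B \<and> frac (y' (s a)) = frac (y a)"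
    unfolding Bex_def by (rule bchoice[THEN exE])
  then have s: "\<And>a. a \<in> ?B \<Longrightarrow> s a \<in> ?B" "\<And>a. a \<in> ?B \<Longrightarrow> frac (y' (s a)) = frac (y a)"
    by blast+
  define k where "k a = \<lfloor>y a\<rfloor> - \<lfloor>y' (s a)\<rfloor>" for a
  have y': "y' (s a) = y a - of_int (k a)" if "a \<in> ?B" for a
    using s(2)[OF that] by (simp add: k_def frac_def)
  have bnd: "0 < x a - x b \<and> x a - x b < 1" if "in_alcove ?B x" "a \<in> ?B" "b \<in> ?B" "a < b" for x a b
    using that unfolding in_alcove_def by blast
  have bnd': "\<bar>y' (s a) - y' (s b)\<bar> < 1" if "a \<in> ?B" "b \<in> ?B" for a b
    using bnd[OF assms(2) s(1)[OF that(1)] s(1)[OF that(2)]] bnd[OF assms(2) s(1)[OF that(2)] s(1)[OF that(1)]]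
    by (cases "s a" "s b" rule: linorder_cases) auto
  \<comment> \<open>A difference in (0,1) minus one in (-1,1) lies in (-1,2), which leaves only the
    integers 0 and 1.\<close>
  have k: "k b \<le> k a \<and> k a \<le> k b + 1" if "a \<in> ?B" "b \<in> ?B" "a < b" for a b
  proof -
    have "real_of_int (k a) - real_of_int (k b) = (y a - y b) - (y' (s a) - y' (s b))"
      using y' that by simp
    then have "real_of_int (k a) - real_of_int (k b) > -1" "real_of_int (k a) - real_of_int (k b) < 2"
      using bnd'[OF that(1,2)] bnd[OF assms(1) that] by (simp_all add: abs_less_iff)
    then show ?thesis by linarith
  qed
  have inj: "inj_on s ?B"
  proof (rule linorder_inj_onI')
    fix a b assume ab: "a \<in> ?B" "b \<in> ?B" "a < b"
    show "s a \<noteq> s b"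
    proof
      assume "s a = s b"
      then have "y a - y b = of_int (k a - k b)" using y'[OF ab(1)] y'[OF ab(2)] by simp
      then have "y a - y b \<in> \<int>" by simp
      then show False using bnd[OF assms(1) ab] not_Ints_between by blast
    qed
  qed
  have img: "s ` ?B = ?B" using s(1) inj by (intro endo_inj_surj) auto
  have "sum y' ?B = (\<Sum>a\<in>?B. y' (s a))"
    using sum.reindex[OF inj, of y'] by (simp add: img)
  also have "\<dots> = sum y ?B - of_int (sum k ?B)"
    using y' by (simp add: sum_subtractf)
  finally have "of_int (sum k ?B) = (0 :: real)"
    using assms(3) by (simp add: frac_equiv_def del: of_int_sum)
  then have sum0: "sum k ?B = 0" by (simp only: of_int_eq_0_iff)
  \<comment> \<open>The values of \<open>k\<close> differ by at most 1. A positive one would make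
    all of them nonnegative, and the zero sum would then make all of them zero.\<close>
  have "k a \<le> 0" if a: "a \<in> ?B" for a
  proof (rule ccontr)
    assume "\<not> k a \<le> 0"
    then have "k b \<ge> 0" if "b \<in> ?B" for b
      using k[OF a that] k[OF that a] by (cases a b rule: linorder_cases) auto
    then have "k a = 0"
      using sum_nonneg_eq_0_iff[of ?B k] sum0 a by auto
    then show False using \<open>\<not> k a \<le> 0\<close> by simp
  qed
  then have k0: "k a = 0" if "a \<in> ?B" for a
    using sum_nonneg_eq_0_iff[of ?B "\<lambda>a. - k a"] sum0 that by (auto simp: sum_negf)
  have y's: "y' (s a) = y a" if "a \<in> ?B" for a using y' k0 that by simp
  have mono: "s a < s b" if ab: "a \<in> ?B" "b \<in> ?B" "a < b" for a b
  proof (rule ccontr)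
    assume "\<not> s a < s b"
    moreover have "s a \<noteq> s b" using inj ab by (auto dest: inj_onD)
    ultimately have "s b < s a" by simp
    then show False
      using bnd[OF assms(2) s(1)[OF ab(2)] s(1)[OF ab(1)]] bnd[OF assms(1) ab] y's ab by simp
  qed
  then have "s a = a" using strict_mono_on_interval_id[OF img mono assms(4)] by simp
  then show ?thesis using y's[OF assms(4)] by simp
qed

section \<open>The factorization of the translation\<close>

text \<open>A root of R_P has both indices in one block, hence both inside \<open>B\<close> or both
  outside, so its entries over \<open>B\<close> sum to zero. Such integer vectors form a subgroup
  \<open>?T\<close>.\<close>

lemma int_span_roots_P_frac_equiv:
  assumes "l \<in> int_span (roots_P n m)" "B = {1..m} \<or> B = {m + 1..n}"
  shows "frac_equiv B y (y + l)"
proof -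
  let ?T = "{l. (\<forall>k. l k \<in> \<int>) \<and> sum l B = 0}"
  have "finite B" using assms(2) by auto
  have evec_sum_B: "sum (evec i) B = (if i \<in> B then 1 else 0)" for i
    using \<open>finite B\<close> by (simp add: evec_def)
  have "roots_P n m \<subseteq> ?T"
  proof
    fix \<alpha> assume "\<alpha> \<in> roots_P n m"
    then obtain i j where ij: "\<alpha> = evec i - evec j"
      "i \<in> {1..m} \<and> j \<in> {1..m} \<or> i \<in> {m + 1..n} \<and> j \<in> {m + 1..n}"
      unfolding roots_P_def by blast
    then have "i \<in> B \<longleftrightarrow> j \<in> B" using assms(2) by auto
    then have "sum \<alpha> B = 0"
      by (simp add: ij(1) sum_subtractf evec_sum_B)
    moreover have "\<alpha> k \<in> \<int>" for k by (simp add: ij(1) evec_def)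
    ultimately show "\<alpha> \<in> ?T" by blast
  qed
  then have "int_span (roots_P n m) \<subseteq> ?T"
    by (rule int_span_subset) (auto simp: sum.distrib sum_negf)
  then show ?thesis
    using assms(1) by (intro frac_equiv_add) auto
qed

lemma I_P_word_frac_equiv:
  assumes "u \<in> lists (I_P n m)" "B = {1..m} \<or> B = {m + 1..n}"
  shows "frac_equiv B y (wact n u y)"
  using assms(1)
proof (induction u)
  case (Cons i u)
  then have i: "i \<in> {1..n - 1}" "i \<noteq> m" by (auto simp: I_P_def)
  \<comment> \<open>The only adjacent pair separated by the two blocks is m, m + 1, and
    \<open>i \<noteq> m\<close>.\<close>
  then have "i \<in> B \<longleftrightarrow> i + 1 \<in> B" using assms(2) by auto
  then have step: "frac_equiv B (wact n u y) (wact n u y \<circ> transpose i (i + 1))"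
    by (rule frac_equiv_transpose)
  have "wact n (i # u) y = wact n u y \<circ> transpose i (i + 1)"
    using i by (simp add: aff_act_gen_def)
  then show ?case
    using frac_equiv_trans[OF Cons.IH step] by (simp only:)
qed (simp add: frac_equiv_refl)

lemma I_P_lists: "lists (I_P n m) \<subseteq> lists {..<n}"
  by (intro lists_mono) (auto simp: I_P_def)

lemma inv_gen:
  assumes "i < n" shows "inv\<^bsub>aff_sym n\<^esub> (gen n i) = gen n i"
proof -
  interpret group "aff_sym n" by (rule group_aff_sym)
  have i: "[i] \<in> lists {..<n}" using assms by simp
  have "gen n i \<otimes>\<^bsub>aff_sym n\<^esub> gen n i = wcls n [i, i]"
    using mult_wcls[OF i i] by (simp add: gen_def)
  also have "\<dots> = \<one>\<^bsub>aff_sym n\<^esub>"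
    using word_rel.invol[OF assms] equiv_class_eq[OF equiv_word_rel] by (simp add: one_aff_sym)
  finally show ?thesis
    using i by (intro inv_equality) (auto simp: carrier_aff_sym gen_def)
qed

text \<open>Generators are their own inverses, so closing under inverses produces no letters outside
  \<open>I_P\<close>.\<close>

lemma sym_P_eq: "sym_P n m = wcls n ` lists (I_P n m)"
proof
  have gen: "gen n i \<in> wcls n ` lists (I_P n m)" if "i \<in> I_P n m" for i
    using that unfolding gen_def by (intro imageI) simp
  show "sym_P n m \<subseteq> wcls n ` lists (I_P n m)"
  proof
    fix w assume "w \<in> sym_P n m"
    then show "w \<in> wcls n ` lists (I_P n m)"
      unfolding sym_P_def
    proof (induction rule: generate.induct)
      case one
      show ?case unfolding one_aff_sym by (intro imageI) simp
    next
      case (incl h)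
      then show ?case using gen by blast
    next
      case (inv h)
      then obtain i where i: "i \<in> I_P n m" "h = gen n i" by blast
      then have "i < n" by (auto simp: I_P_def)
      then show ?case using gen[OF i(1)] by (simp add: i(2) inv_gen)
    next
      case (eng h1 h2)
      then obtain u v where uv: "u \<in> lists (I_P n m)" "v \<in> lists (I_P n m)" "h1 = wcls n u" "h2 = wcls n v"
        by blast
      then have "h1 \<otimes>\<^bsub>aff_sym n\<^esub> h2 = wcls n (u @ v)"
        using mult_wcls I_P_lists by blast
      moreover have "u @ v \<in> lists (I_P n m)" using uv by simp
      ultimately show ?case by blast
    qed
  qed
  show "wcls n ` lists (I_P n m) \<subseteq> sym_P n m"
  proof (rule image_subsetI)
    fix u assume "u \<in> lists (I_P n m)"
    then show "wcls n u \<in> sym_P n m"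
    proof (induction u)
      case Nil
      show ?case
        unfolding sym_P_def using generate.one[of "aff_sym n"] by (simp only: one_aff_sym)
    next
      case (Cons i u)
      have "gen n i \<otimes>\<^bsub>aff_sym n\<^esub> wcls n u \<in> sym_P n m"
        using generate.eng[OF generate.incl[OF imageI[OF Cons.hyps(1)]] Cons.IH[unfolded sym_P_def]]
        by (simp only: sym_P_def)
      moreover have "[i] \<in> lists {..<n}" "u \<in> lists {..<n}"
        using Cons.hyps I_P_lists[of n m] by (auto simp: I_P_def)
      then have "gen n i \<otimes>\<^bsub>aff_sym n\<^esub> wcls n u = wcls n ([i] @ u)"
        unfolding gen_def by (rule mult_wcls)
      ultimately show ?case by simp
    qed
  qed
qed

lemma lower_P_word:
  assumes "w \<in> aff_sym_lower_P n m" "3 \<le> n" "m \<le> n"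
  obtains x where "x \<in> lists {..<n}" "w = wcls n x"
    "\<And>B c. B = {1..m} \<or> B = {m + 1..n} \<Longrightarrow> frac_equiv B c (wact n x c)"
proof -
  obtain v l where vl: "w = v \<otimes>\<^bsub>aff_sym n\<^esub> transl n l" "l \<in> int_span (roots_P n m)" "v \<in> sym_P n m"
    using assms(1) unfolding aff_sym_lower_P_def root_lattice_P_def by blast
  obtain u where u: "u \<in> lists (I_P n m)" "v = wcls n u"
    using vl(3) unfolding sym_P_eq by blast
  obtain t where t: "t \<in> lists {..<n}" "\<And>c. wact n t c = c + l"
    by (rule translation_word[OF roots_P_subset[OF assms(3)] vl(2) assms(2)]) (rule that)
  have u': "u \<in> lists {..<n}" using u(1) I_P_lists by blast
  have w: "w = wcls n (u @ t)"
    using mult_wcls[OF u' t(1)] transl_eqI[OF t(1) assms(2) t(2)] by (simp only: vl(1) u(2))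
  have "frac_equiv B c (wact n (u @ t) c)" if "B = {1..m} \<or> B = {m + 1..n}" for B c
    using frac_equiv_trans[OF int_span_roots_P_frac_equiv[OF vl(2) that] I_P_word_frac_equiv[OF u(1) that]]
    by (simp add: t(2))
  moreover have "u @ t \<in> lists {..<n}" using u' t(1) by simp
  ultimately show ?thesis using w that by blast
qed

lemma wact_supp: "u \<in> lists {..<n} \<Longrightarrow> k \<notin> {1..n} \<Longrightarrow> wact n u c k = c k"
proof (induction u)
  case (Cons i u)
  then show ?case by (auto simp: aff_act_gen_def transpose_def)
qed simp

text \<open>Given two factorizations of \<open>w\<close>, apply both to c =
  w^-1(\<open>alcove_pt\<close>). The lower factors send \<open>c\<close> to the points y and y'
  attached to the upper factors, so y and y' share the block invariants; lying in the block alcoves,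
  they coincide, and faithfulness identifies the upper factors.\<close>

lemma pi_P_eqI:
  assumes "3 \<le> n" "1 \<le> m" "m \<le> n"
    and w1: "w1 \<in> aff_sym_upper_P n m" and w2: "w2 \<in> aff_sym_lower_P n m"
    and w: "w = w1 \<otimes>\<^bsub>aff_sym n\<^esub> w2"
  shows "pi_P n m w = w1"
  unfolding pi_P_def
proof (rule the_equality)
  show "w1 \<in> aff_sym_upper_P n m \<and> (\<exists>w2\<in>aff_sym_lower_P n m. w = w1 \<otimes>\<^bsub>aff_sym n\<^esub> w2)"
    using w1 w2 w by blast
next
  fix w1' assume "w1' \<in> aff_sym_upper_P n m \<and> (\<exists>w2\<in>aff_sym_lower_P n m. w = w1' \<otimes>\<^bsub>aff_sym n\<^esub> w2)"
  then obtain w2' where w1': "w1' \<in> aff_sym_upper_P n m" and w2': "w2' \<in> aff_sym_lower_P n m"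
    and w': "w = w1' \<otimes>\<^bsub>aff_sym n\<^esub> w2'" by blast
  obtain u where u: "u \<in> lists {..<n}" "w1 = wcls n u"
    using w1 unfolding aff_sym_upper_P_def carrier_aff_sym by blast
  obtain u' where u': "u' \<in> lists {..<n}" "w1' = wcls n u'"
    using w1' unfolding aff_sym_upper_P_def carrier_aff_sym by blast
  obtain x where x: "x \<in> lists {..<n}" "w2 = wcls n x"
    "\<And>B c. B = {1..m} \<or> B = {m + 1..n} \<Longrightarrow> frac_equiv B c (wact n x c)"
    by (rule lower_P_word[OF w2 assms(1,3)]) (rule that)
  obtain x' where x': "x' \<in> lists {..<n}" "w2' = wcls n x'"
    "\<And>B c. B = {1..m} \<or> B = {m + 1..n} \<Longrightarrow> frac_equiv B c (wact n x' c)"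
    by (rule lower_P_word[OF w2' assms(1,3)]) (rule that)
  have "wcls n (u @ x) = wcls n (u' @ x')"
    using w w' mult_wcls[OF u(1) x(1)] mult_wcls[OF u'(1) x'(1)] by (simp only: u(2) u'(2) x(2) x'(2))
  then have rel: "(u @ x, u' @ x') \<in> word_rel n"
    using u(1) u'(1) x(1) x'(1) by (subst (asm) wcls_eq_iff) simp_all
  define y where "y = wact n (rev u) (alcove_pt n)"
  define y' where "y' = wact n (rev u') (alcove_pt n)"
  define c where "c = wact n (rev x) y"
  have xc: "wact n x c = y" unfolding c_def using x(1) assms(1) by (rule wact_rev')
  have "wact n (u' @ x') c = wact n u (wact n x c)"
    using wact_word_rel[OF rel assms(1), of c] by simp
  also have "\<dots> = alcove_pt n"
    unfolding xc y_def using u(1) assms(1) by (rule wact_rev')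
  finally have "wact n (rev u') (wact n u' (wact n x' c)) = y'"
    by (simp add: y'_def)
  then have x'c: "wact n x' c = y'" by (simp only: wact_rev[OF u'(1) assms(1)])
  have equiv: "frac_equiv B y y'" if "B = {1..m} \<or> B = {m + 1..n}" for B
    using frac_equiv_trans[OF frac_equiv_sym[OF x(3)[OF that, of c]] x'(3)[OF that, of c]]
    by (simp only: xc x'c)
  have alc: "in_alcove {1..m} y" "in_alcove {m + 1..n} y" "in_alcove {1..m} y'" "in_alcove {m + 1..n} y'"
    using w1 w1' upper_P_iff[OF u(1) assms(1,3)] upper_P_iff[OF u'(1) assms(1,3)]
    by (simp_all only: u(2) u'(2) y_def y'_def)
  have rev: "rev u \<in> lists {..<n}" "rev u' \<in> lists {..<n}"
    using u(1) u'(1) by (simp_all add: in_lists_conv_set)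
  have "y = y'"
  proof
    fix k
    consider "k \<in> {1..m}" | "k \<in> {m + 1..n}" | "k \<notin> {1..n}" by fastforce
    then show "y k = y' k"
    proof cases
      case 1
      show ?thesis by (rule in_alcove_unique[OF alc(1,3) equiv 1]) simp
    next
      case 2
      show ?thesis by (rule in_alcove_unique[OF alc(2,4) equiv 2]) simp
    next
      case 3
      then show ?thesis
        unfolding y_def y'_def by (simp only: wact_supp[OF rev(1)] wact_supp[OF rev(2)] not_False_eq_True)
    qed
  qed
  then have "(rev u, rev u') \<in> word_rel n"
    unfolding y_def y'_def using rev assms(1) by (intro wact_faithful)
  \<comment> \<open>Faithfulness was applied to the inverses; reversal returns to the elements
    themselves.\<close>
  then have "(u, u') \<in> word_rel n" using word_rel_rev by fastforce
  then show "w1' = w1"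
    using equiv_class_eq[OF equiv_word_rel] by (simp only: u(2) u'(2))
qed

section \<open>Explicit action of the words in the factorization\<close>

lemma wact_upt:
  assumes "1 \<le> a" "a \<le> b"
  shows "wact n [a..<b] c = (\<lambda>k. if k = a then c b else if a < k \<and> k \<le> b then c (k - 1) else c k)"
  using assms(2)
\<comment> \<open>The letter appended at the end of the word acts first and changes the argument, so
  \<open>c\<close> must vary. In the reversed word below it acts last.\<close>
proof (induction b arbitrary: c rule: dec_induct)
  case (step b)
  then show ?case using assms(1)
    by (auto simp: aff_act_gen_def fun_eq_iff transpose_def)
qed auto

lemma wact_rev_upt:
  assumes "1 \<le> a" "a \<le> b"
  shows "wact n (rev [a..<b]) c = (\<lambda>k. if k = b then c a else if a \<le> k \<and> k < b then c (k + 1) else c k)"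
  using assms(2)
proof (induction b rule: dec_induct)
  case (step b)
  then show ?case using assms(1)
    by (auto simp: aff_act_gen_def fun_eq_iff transpose_def)
qed auto

lemma wact_zero: "aff_act_gen n 0 c = c(1 := c n + 1, n := c 1 - 1)"
  by (simp add: aff_act_gen_def)

text \<open>With p = \<open>alcove_pt n\<close>, the inverse of the word sends p to (p_m + 1, p_1,
  ..., p_(m-1)) on the first block and (p_(m+2), ..., p_n, p_(m+1) - 1) on the second. Each list is
  decreasing with spread less than 1.\<close>

lemma upper_P_word:
  assumes "3 \<le> n" "1 \<le> m" "m \<le> n - 1"
  shows "wcls n ([m..<n] @ rev [0..<m]) \<in> aff_sym_upper_P n m"
proof -
  let ?p = "alcove_pt n"
  let ?u = "[m..<n] @ rev [0..<m]"
  have u: "?u \<in> lists {..<n}" using assms by auto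
  let ?y = "wact n (rev ?u) ?p"
  have "rev ?u = [0] @ [1..<m] @ rev [m..<n]"
    using assms by (simp add: upt_conv_Cons)
  then have y: "?y = aff_act_gen n 0 (wact n [1..<m] (wact n (rev [m..<n]) ?p))"
    by (simp only: foldr_append foldr.simps o_apply id_apply)
  have "m \<le> n" using assms by simp
  note y' = y[unfolded wact_rev_upt[OF assms(2) \<open>m \<le> n\<close>] wact_upt[OF order.refl assms(2)] wact_zero]
  have y1: "?y k = (if k = 1 then ?p m + 1 else ?p (k - 1))" if "k \<in> {1..m}" for k
    using that assms unfolding y' by auto
  have y2: "?y k = (if k = n then ?p (m + 1) - 1 else ?p (k + 1))" if "k \<in> {m + 1..n}" for k
    using that assms unfolding y' by auto
  have p: "0 < ?p a - ?p b" "?p a - ?p b < 1" if "a \<in> {1..n}" "b \<in> {1..n}" "a < b" for a b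
    using alcove_pt_diff_bounds[OF that] by simp_all
  have "in_alcove {1..m} ?y"
    unfolding in_alcove_def
  proof (intro ballI impI)
    fix a b assume ab: "a \<in> {1..m}" "b \<in> {1..m}" "a < b"
    have b: "?y b = ?p (b - 1)" using y1[OF ab(2)] ab by simp
    show "0 < ?y a - ?y b \<and> ?y a - ?y b < 1"
    proof (cases "a = 1")
      case True
      have "?y a = ?p m + 1" using y1[OF ab(1)] True by simp
      moreover have "b - 1 \<in> {1..n}" "m \<in> {1..n}" "b - 1 < m" using ab assms by auto
      ultimately show ?thesis unfolding b using p[of "b - 1" m] by simp
    next
      case False
      have "?y a = ?p (a - 1)" using y1[OF ab(1)] False by simp
      moreover have "a - 1 \<in> {1..n}" "b - 1 \<in> {1..n}" "a - 1 < b - 1" using ab assms False by auto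
      ultimately show ?thesis unfolding b using p[of "a - 1" "b - 1"] by simp
    qed
  qed
  moreover have "in_alcove {m + 1..n} ?y"
    unfolding in_alcove_def
  proof (intro ballI impI)
    fix a b assume ab: "a \<in> {m + 1..n}" "b \<in> {m + 1..n}" "a < b"
    have a: "?y a = ?p (a + 1)" using y2[OF ab(1)] ab by simp
    show "0 < ?y a - ?y b \<and> ?y a - ?y b < 1"
    proof (cases "b = n")
      case True
      have "?y b = ?p (m + 1) - 1" using y2[OF ab(2)] True by simp
      moreover have "m + 1 \<in> {1..n}" "a + 1 \<in> {1..n}" "m + 1 < a + 1" using ab assms by auto
      ultimately show ?thesis unfolding a using p[of "m + 1" "a + 1"] by simp
    next
      case False
      have "?y b = ?p (b + 1)" using y2[OF ab(2)] False by simp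
      moreover have "a + 1 \<in> {1..n}" "b + 1 \<in> {1..n}" "a + 1 < b + 1" using ab assms False by auto
      ultimately show ?thesis unfolding a using p[of "a + 1" "b + 1"] by simp
    qed
  qed
  ultimately show ?thesis
    unfolding upper_P_iff[OF u assms(1) \<open>m \<le> n\<close>] by blast
qed

lemma finite_roots_P: "m \<le> n \<Longrightarrow> finite (roots_P n m)"
  by (rule finite_subset[OF roots_P_subset finite_roots])

text \<open>The word u v acts as translation by e_(m+1) - e_m. This differs from -\<theta> by a
  vector of Q_P, which the factor \<open>t_\<lambda>\<close> supplies.\<close>

lemma wact_factorization:
  assumes "3 \<le> n" and "1 \<le> m" and "m \<le> n - 1"
  shows "wact n [m..<n] (wact n (rev [1..<m]) (aff_act_gen n 0
    (wact n [1..<m] (wact n (rev [m + 1..<n]) c)))) = c(m := c m - 1, m + 1 := c (m + 1) + 1)"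
proof -
  have m: "1 \<le> m + 1" "m + 1 \<le> n" "m \<le> n" using assms by auto
  \<comment> \<open>\<open>?d\<close> is the point just after \<open>s_0\<close> has acted and
    \<open>?e\<close> the point after the first block has been rotated back; the last rotation
    restores all coordinates except m and m + 1.\<close>
  let ?d = "\<lambda>k. if k = 1 then c (m + 1) + 1 else if 1 < k \<and> k \<le> m then c (k - 1)
    else if k = n then c m - 1 else if m < k \<and> k < n then c (k + 1) else c k"
  let ?e = "\<lambda>k. if k = m then c (m + 1) + 1 else if k = n then c m - 1
    else if m < k \<and> k < n then c (k + 1) else c k"
  have "aff_act_gen n 0 (wact n [1..<m] (wact n (rev [m + 1..<n]) c)) = ?d"
  proof
    fix k
    show "aff_act_gen n 0 (wact n [1..<m] (wact n (rev [m + 1..<n]) c)) k = ?d k"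
      unfolding wact_rev_upt[OF m(1,2)] wact_upt[OF order.refl assms(2)] wact_zero
      using assms by auto
  qed
  moreover have "wact n (rev [1..<m]) ?d = ?e"
  proof
    fix k
    show "wact n (rev [1..<m]) ?d k = ?e k"
      unfolding wact_rev_upt[OF order.refl assms(2)] using assms by auto
  qed
  moreover have "wact n [m..<n] ?e = c(m := c m - 1, m + 1 := c (m + 1) + 1)"
  proof
    fix k
    show "wact n [m..<n] ?e k = (c(m := c m - 1, m + 1 := c (m + 1) + 1)) k"
      unfolding wact_upt[OF assms(2) m(3)] using assms by auto
  qed
  ultimately show ?thesis by (simp only:)
qed

theorem proposition3p9:
  fixes n m :: nat
  assumes "3 \<le> n" and "1 \<le> m" and "m \<le> n - 1"
  shows "pi_P n m (transl n (- theta n)) = gen_prod n ([m..<n] @ rev [0..<m])"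
proof -
  \<comment> \<open>This is -\<theta> + (e_m - e_(m+1)), regrouped as one difference within each
    block so that membership in Q_P is visible.\<close>
  define l where "l = (evec m - evec 1) + (evec n - evec (m + 1))"
  let ?u = "[m..<n] @ rev [0..<m]" and ?v = "[1..<m] @ rev [m + 1..<n]"
  have "m \<le> n" using assms by simp
  have u: "?u \<in> lists {..<n}" using assms by auto
  have v: "?v \<in> lists (I_P n m)" using assms by (auto simp: I_P_def)
  then have v': "?v \<in> lists {..<n}" using I_P_lists by blast
  \<comment> \<open>Equal indices are allowed because the differences in \<open>l\<close> degenerate
    to zero when m = 1 or m = n - 1.\<close>
  have base: "evec i - evec j \<in> int_span (roots_P n m)"
    if "i \<in> {1..m} \<and> j \<in> {1..m} \<or> i \<in> {m + 1..n} \<and> j \<in> {m + 1..n}" for i j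
  proof (cases "i = j")
    case True
    then show ?thesis using int_span_zero by simp
  next
    case False
    then have "evec i - evec j \<in> roots_P n m" unfolding roots_P_def using that by blast
    then show ?thesis by (rule int_span_base[OF finite_roots_P[OF \<open>m \<le> n\<close>]])
  qed
  have l: "l \<in> int_span (roots_P n m)"
    unfolding l_def using assms by (intro int_span_add base) auto
  obtain x where x: "x \<in> lists {..<n}" "\<And>c. wact n x c = c + l"
    by (rule translation_word[OF roots_P_subset[OF \<open>m \<le> n\<close>] l assms(1)]) (rule that)
  have ux: "?v @ x \<in> lists {..<n}" "?u @ ?v @ x \<in> lists {..<n}" using u v' x(1) by simp_all
  have lower: "wcls n (?v @ x) \<in> aff_sym_lower_P n m"
  proof -
    have "wcls n ?v \<in> sym_P n m" unfolding sym_P_eq using v by (rule imageI)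
    moreover have "wcls n (?v @ x) = wcls n ?v \<otimes>\<^bsub>aff_sym n\<^esub> transl n l"
      unfolding transl_eqI[OF x(1) assms(1) x(2)] mult_wcls[OF v' x(1)] ..
    ultimately show ?thesis
      unfolding aff_sym_lower_P_def root_lattice_P_def using l by blast
  qed
  have act: "wact n (?u @ ?v @ x) c = c + - theta n" for c
  proof -
    \<comment> \<open>The letter 0 is split off so that the word has the shape treated in
      \<open>wact_factorization\<close>.\<close>
    have "?u @ ?v @ x = [m..<n] @ rev [1..<m] @ [0] @ [1..<m] @ rev [m + 1..<n] @ x"
      using assms by (simp add: upt_conv_Cons)
    then have "wact n (?u @ ?v @ x) c = wact n [m..<n] (wact n (rev [1..<m]) (aff_act_gen n 0
        (wact n [1..<m] (wact n (rev [m + 1..<n]) (c + l)))))"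
      by (simp only: foldr_append foldr.simps o_apply id_apply x(2))
    also have "\<dots> = (c + l)(m := (c + l) m - 1, m + 1 := (c + l) (m + 1) + 1)"
      by (rule wact_factorization[OF assms])
    also have "\<dots> = c + - theta n"
      by (auto simp: fun_eq_iff l_def theta_def evec_def)
    finally show ?thesis .
  qed
  have "transl n (- theta n) = wcls n ?u \<otimes>\<^bsub>aff_sym n\<^esub> wcls n (?v @ x)"
    unfolding mult_wcls[OF u ux(1)] by (rule transl_eqI[OF ux(2) assms(1) act])
  then have "pi_P n m (transl n (- theta n)) = wcls n ?u"
    by (rule pi_P_eqI[OF assms(1,2) \<open>m \<le> n\<close> upper_P_word[OF assms] lower])
  then show ?thesis by (simp only: gen_prod_eq[OF u])
qed

end
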